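(* Let $F$ be a perfect idyll, let $N$ and $M$ be $F$-matroids with respective ground sets $S$ and $T$, and let $\Phi:N\to M$ be an $F$-morphism. Let $A\subseteq S$ and $B\subseteq T$ be subsets with complements $A^c=S-A$ and $B^c=T-B$. If $\underline\Phi(\underline A)\subseteq\underline B$, then \[ \Phi|(A\to B):N|A\to M|B\qquad\text{and}\qquad\Phi/(A\to B):N/A\to M/B \] are $F$-morphisms. They satisfy $\Phi^t|(B^c\to A^c)=\big(\Phi/(A\to B)\big)^t$ and $f_\ast\big(\Phi|(A\to B)\big)=(f_\ast\Phi)|(A\to B)$ for any morphism $f:F\to G$ of perfect idylls.
   Context: An idyll is a commutative multiplicative monoid $F$ with an element $0$ satisfying $0\cdot a=0$ for all $a$ and such that $F^\times=F\setminus\{0\}$ is an abelian group, together with a subset $N_F$ (the nullset) of the group semiring $\mathbb N[F^\times]$ (where $0\in F$ is identified with the empty sum) such that $0\in N_F$, $1\notin N_F$, $N_F+N_F\subseteq N_F$, $\mathbb N[F^\times]\cdot N_F\subseteq N_F$, and there is a unique element $-1\in F^\times$ with $1+(-1)\in N_F$. A morphism of idylls $f:F\to G$ is a multiplicative map with $f(0)=0$, $f(1)=1$ and $\sum f(a_i)\in N_G$ for all $\sum a_i\in N_F$. Let $E$ be a finite set and $r\ge 0$. A Grassmann-Plücker function of rank $r$ on $E$ with coefficients in $F$ is a nonzero function $\varphi:E^r\to F$ that is alternating (i.e. $\varphi(x_{\sigma(1)},\dots,x_{\sigma(r)})=\mathrm{sign}(\sigma)\varphi(x_1,\dots,x_r)$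 for all permutations $\sigma$, and $\varphi(x_1,\dots,x_r)=0$ if the $x_i$ are not pairwise distinct) and satisfies $\sum_{k=0}^r(-1)^k\varphi(y_0,\dots,\widehat{y_k},\dots,y_r)\varphi(y_k,x_2,\dots,x_r)\in N_F$ for all $x_2,\dots,x_r,y_0,\dots,y_r\in E$. An $F$-matroid of rank $r$ on $E$ is a class $M=[\varphi]$ of such functions up to multiplication by elements of $F^\times$. Its underlying matroid $\underline M$ is the ordinary matroid on $E$ with bases $\{x_1,\dots,x_r\}$ for $\varphi(x_1,\dots,x_r)\neq0$. Dual: fix a total order on $E$ and let $n=\#E$; $M^*=[\varphi^*]$ with $\varphi^*:E^{n-r}\to F$, $\varphi^*(x)=0$ if $x$ has repeated entries, and $\varphi^*(x)=\mathrm{sign}(x,x')\varphi(x')$ otherwise, where $x'\in E^r$ lists the complement of the entries of $x$ and $\mathrm{sign}(x,x')\in\{\pm1\}$ is the sign of the permutation sorting $(x,x')$. Circuits: $\mathcal C_M\subseteq F^E$ consists of all $aX_y$ with $a\in F^\times$ and $y=(y_0,\dots,y_r)\in E^{r+1}$ with distinct entries and $\varphi(y_0,\dots,\widehat{y_k},\dots,y_r)\ne0$ for some $k$, where $X_y(y_i)=(-1)^i\varphi(y_0,\dots,\widehat{y_i},\dots,y_r)$ and $X_y(x)=0$ for other $x$. Cocircuits: $\mathcal C_M^*=\mathcal C_{M^*}$. For $X,Y\in F^E$ write $X\perp Y$ if $\sum_{e}X_eY_e\in N_F$. Vectors: $\mathcal V_M=\{X\in F^E: X\perp Y\ \forall Y\in\mathcal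 C_M^*\}$. Covectors: $\mathcal V_M^*=\{X\in F^E:X\perp Y\ \forall Y\in\mathcal C_M\}$. The idyll $F$ is perfect if $X\perp Y$ for all $F$-matroids $M$, $X\in\mathcal V_M$, $Y\in\mathcal V_M^*$. Minors of an $F$-matroid $M=[\varphi]$ of rank $r$ on $E$, for $A\subseteq E$. Contraction: $M/A=[\varphi/A]$ on $E\setminus A$, with $(\varphi/A)(x_1,\dots,x_{r-\ell})=\varphi(x_1,\dots,x_{r-\ell},a_1,\dots,a_\ell)$, where $\{a_1,\dots,a_\ell\}$ is a maximal independent subset of $A$ in $\underline M$. Deletion: $M\backslash A=[\varphi\backslash A]$ on $E\setminus A$, with $(\varphi\backslash A)(y_1,\dots,y_k)=\varphi(y_1,\dots,y_k,b_1,\dots,b_{r-k})$, where $k$ is the rank of $E\setminus A$ in $\underline M$ and $\{b_1,\dots,b_{r-k}\}\subseteq A$ is a basis of $\underline M/(E\setminus A)$. Restriction: $M|A=M\backslash(E\setminus A)$. (These do not depend on the choices.) A submonomial $F$-matrix indexed by $T\times S$ is a matrix $\Phi=(\Phi_{i,j})_{(i,j)\in T\times S}$ with entries in $F$ such that each row and each column has at most one nonzero entry; it defines a map $F^S\to F^T$, $(\Phi\cdot X)_i=\sum_{j}\Phi_{i,j}X_j$. An $F$-morphism $\Phi:N\to M$ is a submonomial $F$-matrix indexed by $T\times S$ with $\Phi\cdot\mathcal V_N\subseteq\mathcal V_M$. The transpose is denoted $\Phi^t$, and $(f_\ast\Phi)_{i,j}=f(\Phi_{i,j})$. For a set $A$,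 $\underline A=A\sqcup\{0\}$. The underlying map $\underline\Phi:\underline S\to\underline T$ is given by $\underline\Phi(j)=i$ if $j\in S$ and $\Phi_{i,j}\ne0$, and $\underline\Phi(j)=0$ if $j=0$ or $\Phi_{i,j}=0$ for all $i\in T$. Define $\Phi|(A\to B)=(\Phi_{i,j})_{(i,j)\in B\times A}$ and $\Phi/(A\to B)=(\Phi_{i,j})_{(i,j)\in B^c\times A^c}$ (called the restriction and contraction of $\Phi$ to $A\to B$, respectively). *)

theory Defs
  imports "HOL-Library.Multiset" "HOL-Combinatorics.Permutations"
begin

section \<open>Idylls\<close>

text \<open>
  Elements of the group semiring \<open>\<nat>[F\<^sup>\<times>]\<close> are multisets of nonzero elements of \<open>F\<close>.
  The first two axioms (with \<open>0 \<noteq> 1\<close> from \<^class>\<open>zero_neq_one\<close>) say that \<open>F - {0}\<close> is an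
  abelian group.
\<close>

class idyll = comm_monoid_mult + mult_zero + zero_neq_one +
  fixes nullset :: "'a multiset set"
  assumes unit_ex: "a \<noteq> 0 \<Longrightarrow> \<exists>b. a * b = 1"
    and nullset_nonzero: "A \<in> nullset \<Longrightarrow> 0 \<notin># A"
    and nullset_zero: "{#} \<in> nullset"
    and nullset_one: "{#1#} \<notin> nullset"
    and nullset_add: "A \<in> nullset \<Longrightarrow> B \<in> nullset \<Longrightarrow> A + B \<in> nullset"
    and nullset_mult: "0 \<notin># A \<Longrightarrow> B \<in> nullset \<Longrightarrow> (\<Sum>a\<in>#A. {#a * b. b \<in># B#}) \<in> nullset"
    and neg_one_ex1: "\<exists>!a. a \<noteq> 0 \<and> {#1#} + {#a#} \<in> nullset"

definition neg_one :: "'f::idyll" where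
  "neg_one = (THE a. a \<noteq> 0 \<and> {#1#} + {#a#} \<in> nullset)"

definition sgn_elt :: "(nat \<Rightarrow> nat) \<Rightarrow> 'f::idyll" where
  "sgn_elt p = (if sign p = 1 then 1 else neg_one)"

text \<open>The embedding \<open>F \<rightarrow> \<nat>[F\<^sup>\<times>]\<close>, which sends \<open>0\<close> to the empty sum.\<close>

definition emb :: "'f::idyll \<Rightarrow> 'f multiset" where
  "emb a = (if a = 0 then {#} else {#a#})"

definition idyll_hom :: "('f::idyll \<Rightarrow> 'g::idyll) \<Rightarrow> bool" where
  "idyll_hom f \<longleftrightarrow>
     (\<forall>a b. f (a * b) = f a * f b) \<and> f 0 = 0 \<and> f 1 = 1 \<and>
     (\<forall>A\<in>nullset. (\<Sum>a\<in>#A. emb (f a)) \<in> nullset)"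


section \<open>Matroids with coefficients in an idyll\<close>

definition tuples :: "'e set \<Rightarrow> nat \<Rightarrow> 'e list set" where
  "tuples E r = {xs. set xs \<subseteq> E \<and> length xs = r}"

definition omit :: "nat \<Rightarrow> 'e list \<Rightarrow> 'e list" where
  "omit k ys = take k ys @ drop (Suc k) ys"

text \<open>
  A function \<open>E\<^sup>r \<rightarrow> F\<close> is a function on lists that vanishes outside \<open>E\<^sup>r\<close>; likewise an element
  of \<open>F\<^sup>E\<close> (see \<open>vects\<close> below) vanishes outside \<open>E\<close>.
  In the relations below \<open>xs\<close> is \<open>(x\<^sub>2, \<dots>, x\<^sub>r)\<close>; there are none for \<open>r = 0\<close>.
\<close>

definition gp_function :: "'e set \<Rightarrow> nat \<Rightarrow> ('e list \<Rightarrow> 'f::idyll) \<Rightarrow> bool" where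
  "gp_function E r \<phi> \<longleftrightarrow>
     (\<forall>xs. xs \<notin> tuples E r \<longrightarrow> \<phi> xs = 0) \<and>
     (\<exists>xs. \<phi> xs \<noteq> 0) \<and>
     (\<forall>xs\<in>tuples E r. \<forall>p. p permutes {..<r} \<longrightarrow> \<phi> (permute_list p xs) = sgn_elt p * \<phi> xs) \<and>
     (\<forall>xs\<in>tuples E r. \<not> distinct xs \<longrightarrow> \<phi> xs = 0) \<and>
     (\<forall>xs ys. set xs \<subseteq> E \<and> Suc (length xs) = r \<and> ys \<in> tuples E (Suc r) \<longrightarrow>
        (\<Sum>k\<le>r. emb (neg_one ^ k * \<phi> (omit k ys) * \<phi> (ys ! k # xs))) \<in> nullset)"

record ('e, 'f) fmatroid =
  ground :: "'e set"
  rk :: nat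
  gps :: "('e list \<Rightarrow> 'f) set"

definition gp_class :: "('e list \<Rightarrow> 'f::idyll) \<Rightarrow> ('e list \<Rightarrow> 'f) set" where
  "gp_class \<phi> = {\<lambda>xs. a * \<phi> xs |a. a \<noteq> 0}"

definition F_matroid :: "('e, 'f::idyll) fmatroid \<Rightarrow> bool" where
  "F_matroid M \<longleftrightarrow> finite (ground M) \<and>
     (\<exists>\<phi>. gp_function (ground M) (rk M) \<phi> \<and> gps M = gp_class \<phi>)"

text \<open>The underlying matroid of \<open>M\<close>: bases, independent sets, bases of a subset, and rank.\<close>

definition bases :: "('e, 'f::idyll) fmatroid \<Rightarrow> 'e set set" where
  "bases M = {set xs |xs. \<exists>\<phi>\<in>gps M. \<phi> xs \<noteq> 0}"

definition indep :: "('e, 'f::idyll) fmatroid \<Rightarrow> 'e set \<Rightarrow> bool" where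
  "indep M I \<longleftrightarrow> (\<exists>B\<in>bases M. I \<subseteq> B)"

definition max_indep_in :: "('e, 'f::idyll) fmatroid \<Rightarrow> 'e set \<Rightarrow> 'e set \<Rightarrow> bool" where
  "max_indep_in M A I \<longleftrightarrow>
     I \<subseteq> A \<and> indep M I \<and> (\<forall>J. I \<subseteq> J \<and> J \<subseteq> A \<and> indep M J \<longrightarrow> J = I)"

definition rank_of :: "('e, 'f::idyll) fmatroid \<Rightarrow> 'e set \<Rightarrow> nat" where
  "rank_of M A = Max {card I |I. I \<subseteq> A \<and> indep M I}"


subsection \<open>Duality\<close>

text \<open>
  A total order on a finite set is fixed by choosing a list of its elements; another choice
  changes \<open>\<phi>\<^sup>*\<close> by a global sign. The complement \<open>x'\<close> is listed in that order.
\<close>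

definition enum_of :: "'e set \<Rightarrow> 'e list" where
  "enum_of E = (SOME es. distinct es \<and> set es = E)"

definition sort_perm :: "'e set \<Rightarrow> 'e list \<Rightarrow> nat \<Rightarrow> nat" where
  "sort_perm E zs = (THE p. p permutes {..<length zs} \<and> permute_list p zs = enum_of E)"

definition dual_gp :: "'e set \<Rightarrow> nat \<Rightarrow> ('e list \<Rightarrow> 'f::idyll) \<Rightarrow> 'e list \<Rightarrow> 'f" where
  "dual_gp E r \<phi> = (\<lambda>xs.
     if xs \<in> tuples E (card E - r) \<and> distinct xs
     then (let xs' = filter (\<lambda>e. e \<notin> set xs) (enum_of E)
           in sgn_elt (sort_perm E (xs @ xs')) * \<phi> xs')
     else 0)"

text \<open>
  The operations \<open>\<phi> \<mapsto> \<phi>\<^sup>*\<close>, \<open>\<phi> \<mapsto> \<phi>/A\<close> and \<open>\<phi> \<mapsto> \<phi>\A\<close> commute with scaling, so the image of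
  the class of \<open>\<phi>\<close> is the class of the image of \<open>\<phi>\<close>.
\<close>

definition dual :: "('e, 'f::idyll) fmatroid \<Rightarrow> ('e, 'f) fmatroid" where
  "dual M = \<lparr>ground = ground M, rk = card (ground M) - rk M,
             gps = dual_gp (ground M) (rk M) ` gps M\<rparr>"


subsection \<open>Circuits, cocircuits, vectors and covectors\<close>

definition vects :: "'e set \<Rightarrow> ('e \<Rightarrow> 'f::idyll) set" where
  "vects E = {X. \<forall>e. e \<notin> E \<longrightarrow> X e = 0}"

definition circuits :: "('e, 'f::idyll) fmatroid \<Rightarrow> ('e \<Rightarrow> 'f) set" where
  "circuits M = {X. \<exists>\<phi>\<in>gps M. \<exists>ys\<in>tuples (ground M) (Suc (rk M)). \<exists>a.
     a \<noteq> 0 \<and> distinct ys \<and> (\<exists>k\<le>rk M. \<phi> (omit k ys) \<noteq> 0) \<and>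
     (\<forall>i\<le>rk M. X (ys ! i) = a * (neg_one ^ i * \<phi> (omit i ys))) \<and>
     (\<forall>e. e \<notin> set ys \<longrightarrow> X e = 0)}"

definition cocircuits :: "('e, 'f::idyll) fmatroid \<Rightarrow> ('e \<Rightarrow> 'f) set" where
  "cocircuits M = circuits (dual M)"

definition orth :: "'e set \<Rightarrow> ('e \<Rightarrow> 'f::idyll) \<Rightarrow> ('e \<Rightarrow> 'f) \<Rightarrow> bool" where
  "orth E X Y \<longleftrightarrow> (\<Sum>e\<in>E. emb (X e * Y e)) \<in> nullset"

definition vectors :: "('e, 'f::idyll) fmatroid \<Rightarrow> ('e \<Rightarrow> 'f) set" where
  "vectors M = {X \<in> vects (ground M). \<forall>Y\<in>cocircuits M. orth (ground M) X Y}"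

definition covectors :: "('e, 'f::idyll) fmatroid \<Rightarrow> ('e \<Rightarrow> 'f) set" where
  "covectors M = {X \<in> vects (ground M). \<forall>Y\<in>circuits M. orth (ground M) X Y}"

text \<open>
  Every finite ground set is in bijection with a finite set of natural numbers, so
  it suffices to let \<open>M\<close> range over the matroids whose ground set is of the latter form.
\<close>

definition perfect_idyll :: "'f::idyll itself \<Rightarrow> bool" where
  "perfect_idyll _ \<longleftrightarrow>
     (\<forall>M :: (nat, 'f) fmatroid. F_matroid M \<longrightarrow>
        (\<forall>X\<in>vectors M. \<forall>Y\<in>covectors M. orth (ground M) X Y))"


subsection \<open>Minors\<close>

definition contract_list :: "('e, 'f::idyll) fmatroid \<Rightarrow> 'e set \<Rightarrow> 'e list" where
  "contract_list M A = (SOME as. distinct as \<and> max_indep_in M A (set as))"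

definition contract :: "('e, 'f::idyll) fmatroid \<Rightarrow> 'e set \<Rightarrow> ('e, 'f) fmatroid" where
  "contract M A =
     (let as = contract_list M A; E = ground M - A; k = rk M - length as
      in \<lparr>ground = E, rk = k,
          gps = (\<lambda>\<phi> xs. if xs \<in> tuples E k then \<phi> (xs @ as) else 0) ` gps M\<rparr>)"

definition delete_list :: "('e, 'f::idyll) fmatroid \<Rightarrow> 'e set \<Rightarrow> 'e list" where
  "delete_list M A = (SOME bs. distinct bs \<and> set bs \<in> bases (contract M (ground M - A)))"

definition delete :: "('e, 'f::idyll) fmatroid \<Rightarrow> 'e set \<Rightarrow> ('e, 'f) fmatroid" where
  "delete M A =
     (let bs = delete_list M A; E = ground M - A; k = rank_of M E
      in \<lparr>ground = E, rk = k,
          gps = (\<lambda>\<phi> ys. if ys \<in> tuples E k then \<phi> (ys @ bs) else 0) ` gps M\<rparr>)"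

definition restrict_to :: "('e, 'f::idyll) fmatroid \<Rightarrow> 'e set \<Rightarrow> ('e, 'f) fmatroid" where
  "restrict_to M A = delete M (ground M - A)"


section \<open>Submonomial matrices and morphisms\<close>

text \<open>The entries of a matrix indexed by \<open>rows \<times> cols\<close> vanish outside this index set.\<close>

record ('t, 's, 'f) fmatrix =
  rows :: "'t set"
  cols :: "'s set"
  entry :: "'t \<Rightarrow> 's \<Rightarrow> 'f"

definition submonomial :: "('t, 's, 'f::idyll) fmatrix \<Rightarrow> bool" where
  "submonomial \<Phi> \<longleftrightarrow>
     (\<forall>i j. entry \<Phi> i j \<noteq> 0 \<longrightarrow> i \<in> rows \<Phi> \<and> j \<in> cols \<Phi>) \<and>
     (\<forall>i j j'. entry \<Phi> i j \<noteq> 0 \<and> entry \<Phi> i j' \<noteq> 0 \<longrightarrow> j = j') \<and>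
     (\<forall>i i' j. entry \<Phi> i j \<noteq> 0 \<and> entry \<Phi> i' j \<noteq> 0 \<longrightarrow> i = i')"

text \<open>
  The sum \<open>\<Sum>\<^sub>j \<Phi>\<^sub>i\<^sub>j X\<^sub>j\<close> has at most one nonzero term, so in \<open>\<nat>[F\<^sup>\<times>]\<close> it is the image of a unique
  element of \<open>F\<close>.
\<close>

definition mat_apply ::
    "('t, 's, 'f::idyll) fmatrix \<Rightarrow> ('s \<Rightarrow> 'f) \<Rightarrow> 't \<Rightarrow> 'f" where
  "mat_apply \<Phi> X i = (THE a. emb a = (\<Sum>j\<in>cols \<Phi>. emb (entry \<Phi> i j * X j)))"

definition F_morphism ::
    "('s, 'f::idyll) fmatroid \<Rightarrow> ('t, 'f) fmatroid \<Rightarrow> ('t, 's, 'f) fmatrix \<Rightarrow> bool" where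
  "F_morphism N M \<Phi> \<longleftrightarrow>
     F_matroid N \<and> F_matroid M \<and>
     submonomial \<Phi> \<and> rows \<Phi> = ground M \<and> cols \<Phi> = ground N \<and>
     mat_apply \<Phi> ` vectors N \<subseteq> vectors M"

definition mat_transpose :: "('t, 's, 'f) fmatrix \<Rightarrow> ('s, 't, 'f) fmatrix" where
  "mat_transpose \<Phi> = \<lparr>rows = cols \<Phi>, cols = rows \<Phi>, entry = (\<lambda>j i. entry \<Phi> i j)\<rparr>"

definition mat_map :: "('f \<Rightarrow> 'g) \<Rightarrow> ('t, 's, 'f) fmatrix \<Rightarrow> ('t, 's, 'g) fmatrix" where
  "mat_map f \<Phi> = \<lparr>rows = rows \<Phi>, cols = cols \<Phi>, entry = (\<lambda>i j. f (entry \<Phi> i j))\<rparr>"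

definition mat_restrict ::
    "('t, 's, 'f::idyll) fmatrix \<Rightarrow> 's set \<Rightarrow> 't set \<Rightarrow> ('t, 's, 'f) fmatrix" where
  "mat_restrict \<Phi> A B =
     \<lparr>rows = B, cols = A, entry = (\<lambda>i j. if i \<in> B \<and> j \<in> A then entry \<Phi> i j else 0)\<rparr>"

definition mat_contract ::
    "('t, 's, 'f::idyll) fmatrix \<Rightarrow> 's set \<Rightarrow> 't set \<Rightarrow> ('t, 's, 'f) fmatrix" where
  "mat_contract \<Phi> A B =
     (let A' = cols \<Phi> - A; B' = rows \<Phi> - B
      in \<lparr>rows = B', cols = A', entry = (\<lambda>i j. if i \<in> B' \<and> j \<in> A' then entry \<Phi> i j else 0)\<rparr>)"

text \<open>\<^const>\<open>None\<close> is the base point \<open>0\<close> of the pointed set.\<close>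

definition pointed :: "'a set \<Rightarrow> 'a option set" where
  "pointed A = insert None (Some ` A)"

definition underlying_map ::
    "('t, 's, 'f::idyll) fmatrix \<Rightarrow> 's option \<Rightarrow> 't option" where
  "underlying_map \<Phi> x =
     (case x of
        None \<Rightarrow> None
      | Some j \<Rightarrow> (if \<exists>i. entry \<Phi> i j \<noteq> 0 then Some (THE i. entry \<Phi> i j \<noteq> 0) else None))"

end

theory Submission
  imports Defs
begin

text \<open>
  Everything rests on one duality argument. Multiplication by a submonomial matrix \<open>\<Phi>\<close> is adjoint
  to multiplication by its transpose for the pairing \<open>\<Sum> X\<^sub>e Y\<^sub>e\<close> with values in the group semiring
  (\<open>mat_transpose_adjoint\<close>). If \<open>Y\<close> is a cocircuit of \<open>M\<close> and \<open>Z\<close> a circuit of \<open>N\<close>, then \<open>Z\<close> is a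
  vector of \<open>N\<close> by the Pluecker relations, so \<open>\<Phi> Z\<close> is a vector of \<open>M\<close> and is orthogonal to \<open>Y\<close>.
  Hence \<open>\<Phi>\<^sup>t Y\<close> is orthogonal to all circuits of \<open>N\<close>, that is, a covector
  (\<open>transpose_cofactor_covector\<close>).

  A cocircuit of \<open>M|B\<close> is a restriction of a cocircuit \<open>Y\<close> of \<open>M\<close>, and a cocircuit of \<open>M/B\<close> is a
  cocircuit \<open>Y\<close> of \<open>M\<close> that vanishes on \<open>B\<close>. The condition on the underlying map says that \<open>\<Phi>\<close> has
  no nonzero entry in \<open>B\<^sup>c \<times> A\<close>. So in the first case \<open>\<Phi>\<^sup>t Y\<close> on \<open>A\<close> is computed by the
  restricted matrix, and in the second case \<open>\<Phi>\<^sup>t Y\<close> vanishes on \<open>A\<close> and is computed by the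
  contracted matrix. The circuits of \<open>N|A\<close> are circuits of \<open>N\<close>, and those of \<open>N/A\<close> are restrictions
  of circuits of \<open>N\<close>; therefore the covector \<open>\<Phi>\<^sup>t Y\<close> restricts to a covector of \<open>N|A\<close> in the first
  case, and of \<open>N/A\<close> in the second. Perfection, applied to this minor of \<open>N\<close>, says that its vectors
  \<open>X\<close> are orthogonal to \<open>\<Phi>\<^sup>t Y\<close>; by adjointness the image of \<open>X\<close> is orthogonal to \<open>Y\<close>, as required.

  To work with a Grassmann-Pluecker function \<open>\<phi>\<close> alone, vectors are described as the functions
  orthogonal to all \<open>e \<mapsto> \<phi>(e, z\<^sub>2, \<dots>, z\<^sub>r)\<close> (\<open>vectors_iff\<close>). This eliminates the dual function and
  its signs, makes the passage to minors a matter of appending a fixed list to the arguments of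
  \<open>\<phi>\<close>, and makes the description visibly invariant under relabelling the ground set, so that
  perfection extends from sets of natural numbers to all finite ground sets (\<open>perfect_orth\<close>).
  The one fact of matroid theory in the background is that all maximal independent subsets of a
  set have the same size, on which the rank of a restriction depends; it follows from basis exchange.
\<close>


section \<open>Arithmetic in idylls\<close>

lemma idyll_mult_eq_0_iff [simp]: "a * b = 0 \<longleftrightarrow> a = 0 \<or> b = 0" for a b :: "'f::idyll"
proof
  assume *: "a * b = 0"
  show "a = 0 \<or> b = 0"
  proof (rule disjCI)
    assume "b \<noteq> 0"
    then obtain c where "b * c = 1" using unit_ex by blast
    then have "a = a * b * c" by (simp add: mult.assoc)
    then show "a = 0" using * by simp
  qed
qed auto

lemma emb_0 [simp]: "emb 0 = {#}"
  by (simp add: emb_def)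

lemma emb_eq_iff [simp]: "emb a = emb b \<longleftrightarrow> a = b"
  by (auto simp: emb_def)

lemma nullset_scale:
  fixes c :: "'f::idyll"
  assumes "(\<Sum>i\<in>I. emb (f i)) \<in> nullset"
  shows "(\<Sum>i\<in>I. emb (c * f i)) \<in> nullset"
proof (cases "c = 0")
  case True
  then show ?thesis by (simp add: nullset_zero)
next
  case False
  have "(\<Sum>i\<in>I. emb (c * f i)) = {#c * b. b \<in># (\<Sum>i\<in>I. emb (f i))#}"
    using False by (induction I rule: infinite_finite_induct) (auto simp: emb_def)
  then show ?thesis using nullset_mult[of "{#c#}", OF _ assms] False by simp
qed

lemma singleton_notin_nullset:
  assumes "(a::'f::idyll) \<noteq> 0"
  shows "{#a#} \<notin> nullset"
proof
  assume *: "{#a#} \<in> nullset"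
  obtain b where b: "a * b = 1" using unit_ex assms by blast
  then have "b \<noteq> 0" by auto
  then have "{#b * a#} \<in> nullset" using nullset_mult[of "{#b#}", OF _ *] by simp
  then show False using b nullset_one[where 'a = 'f] by (simp add: mult.commute)
qed

lemma neg_one_nonzero [simp]: "(neg_one::'f::idyll) \<noteq> 0"
  and one_plus_neg_one: "{#1#} + {#neg_one::'f::idyll#} \<in> nullset"
  using theI'[OF neg_one_ex1] unfolding neg_one_def by auto

text \<open>
  Scaling \<open>1 + (-1)\<close> by the inverse of \<open>-1\<close> gives another null sum with a summand \<open>1\<close>, so
  uniqueness of \<open>-1\<close> forces \<open>-1\<close> to be its own inverse.
\<close>

lemma neg_one_square [simp]: "neg_one * neg_one = (1::'f::idyll)"
proof -
  obtain b :: 'f where b: "neg_one * b = 1" using unit_ex neg_one_nonzero by blast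
  then have "b \<noteq> 0" by auto
  then have "{#b#} + {#1#} \<in> nullset"
    using nullset_mult[of "{#b#}", OF _ one_plus_neg_one] b by (simp add: mult.commute)
  then have "b = neg_one"
    using neg_one_ex1 \<open>b \<noteq> 0\<close> one_plus_neg_one neg_one_nonzero
    by (metis add.commute)
  then show ?thesis using b by simp
qed

lemma neg_one_cancel [simp]: "neg_one * (neg_one * a) = (a::'f::idyll)"
  by (simp flip: mult.assoc)

lemma neg_one_power_nonzero [simp]: "neg_one ^ i \<noteq> (0::'f::idyll)"
  by (induction i) auto

lemma sgn_elt_nonzero [simp]: "sgn_elt p \<noteq> (0::'f::idyll)"
  by (simp add: sgn_elt_def)

lemma sgn_elt_compose:
  assumes "permutation p" "permutation q"
  shows "sgn_elt (p \<circ> q) = (sgn_elt p * sgn_elt q :: 'f::idyll)"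
  unfolding sgn_elt_def sign_compose[OF assms] by (simp add: sign_def)


section \<open>Alternating functions on lists\<close>

text \<open>
  It suffices to record adjacent transpositions. The sign rule is imposed on all lists, of
  every length and with repetitions; this is harmless because the functions in question vanish
  outside their domain.
\<close>

definition alternating :: "('e list \<Rightarrow> 'f::idyll) \<Rightarrow> bool" where
  "alternating \<psi> \<longleftrightarrow> (\<forall>us a b vs. \<psi> (us @ b # a # vs) = neg_one * \<psi> (us @ a # b # vs))"

lemma alternating_move:
  assumes "alternating \<psi>"
  shows "\<psi> (us @ vs @ a # ws) = neg_one ^ length vs * \<psi> (us @ a # vs @ ws)"
proof (induction vs arbitrary: us)
  case (Cons v vs)
  have "\<psi> (us @ (v # vs) @ a # ws) = neg_one ^ length vs * \<psi> (us @ v # a # vs @ ws)"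
    using Cons[of "us @ [v]"] by simp
  also have "\<psi> (us @ v # a # vs @ ws) = neg_one * \<psi> (us @ a # v # vs @ ws)"
    using assms unfolding alternating_def by blast
  finally show ?case by (simp add: mult_ac)
qed simp

text \<open>
  Adjacent transpositions generate all rearrangements of a list. For a product of two alternating
  functions the signs cancel, so this applies to it.
\<close>

lemma swap_invariant_mset:
  assumes "\<And>us a b vs. g (us @ b # a # vs) = g (us @ a # b # vs)"
    and "mset xs = mset ys"
  shows "g xs = g ys"
  using assms
proof (induction xs arbitrary: g ys)
  case (Cons x xs)
  obtain us vs where ys: "ys = us @ x # vs"
    using Cons.prems(2) by (metis list.set_intros(1) set_mset_mset split_list)
  note swap = Cons.prems(1)
  have move: "g (ws @ us @ x # vs) = g (ws @ x # us @ vs)" for ws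
  proof (induction us arbitrary: ws)
    case (Cons u us)
    have "g (ws @ (u # us) @ x # vs) = g (ws @ u # x # us @ vs)"
      using Cons[of "ws @ [u]"] by simp
    also have "\<dots> = g (ws @ x # u # us @ vs)" by (rule swap)
    finally show ?case by simp
  qed simp
  have "mset xs = mset (us @ vs)" using Cons.prems(2) ys by simp
  moreover have "g (x # us' @ b # a # vs') = g (x # us' @ a # b # vs')" for us' a b vs'
    using swap[of "x # us'" b a vs'] unfolding append_Cons .
  ultimately have "g (x # xs) = g (x # us @ vs)"
    using Cons.IH[of "\<lambda>w. g (x # w)"] by blast
  then show ?case using move[of "[]"] ys by simp
qed simp

lemma transpose_permutes_adjacent:
  "transpose (length us) (Suc (length us)) permutes {..<length (us @ a # b # vs)}"
  by (rule permutes_swap_id) auto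

lemma permute_list_adjacent:
  "permute_list (transpose (length us) (Suc (length us))) (us @ a # b # vs) = us @ b # a # vs"
proof (rule nth_equalityI)
  fix i assume i: "i < length (permute_list (transpose (length us) (Suc (length us))) (us @ a # b # vs))"
  consider "i < length us" | "i = length us" | "i = Suc (length us)"
    | k where "i = Suc (Suc (length us + k))"
    by (metis less_antisym less_iff_Suc_add not_less_eq)
  then show "permute_list (transpose (length us) (Suc (length us))) (us @ a # b # vs) ! i
      = (us @ b # a # vs) ! i"
    unfolding permute_list_nth[OF transpose_permutes_adjacent i[unfolded length_permute_list]]
    using i by cases (simp_all add: nth_append transpose_def)
qed simp

lemma sgn_elt_transpose: "n \<noteq> m \<Longrightarrow> sgn_elt (transpose n m) = neg_one"
  by (simp add: sgn_elt_def sign_swap_id)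

lemma enum_of: "finite E \<Longrightarrow> distinct (enum_of E) \<and> set (enum_of E) = E"
  unfolding enum_of_def by (rule someI_ex) (metis finite_distinct_list)

text \<open>
  The permutation that sorts a list without repetitions is unique, so the sign of any one found
  explicitly is the sign in the definition of the dual.
\<close>

lemma sort_perm_eqI:
  assumes "distinct zs" "p permutes {..<length zs}" "permute_list p zs = enum_of E"
  shows "sort_perm E zs = p"
  unfolding sort_perm_def
proof (rule the_equality)
  fix q assume q: "q permutes {..<length zs} \<and> permute_list q zs = enum_of E"
  show "q = p"
  proof
    fix i
    show "q i = p i"
    proof (cases "i < length zs")
      case True
      have "zs ! q i = zs ! p i"
        using q assms True permute_list_nth by metis
      moreover have "q i < length zs" "p i < length zs"
        using True q assms(2) permutes_in_image by (metis lessThan_iff)+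
      ultimately show ?thesis using assms(1) nth_eq_iff_index_eq by blast
    next
      case False
      then show ?thesis using q assms(2) by (metis lessThan_iff permutes_def)
    qed
  qed
qed (use assms in auto)

text \<open>
  The sign of the permutation that sorts \<open>zs\<close>, extended by zero to lists that do not enumerate \<open>E\<close>,
  so that it becomes an alternating function in the above sense.
\<close>

definition order_sign :: "'e set \<Rightarrow> 'e list \<Rightarrow> 'f::idyll" where
  "order_sign E zs = (if mset zs = mset (enum_of E) then sgn_elt (sort_perm E zs) else 0)"

lemma alternating_order_sign:
  assumes "finite E"
  shows "alternating (order_sign E :: 'e list \<Rightarrow> 'f::idyll)"
  unfolding alternating_def
proof (intro allI)
  fix us vs :: "'e list" and a b
  let ?xs = "us @ a # b # vs" and ?ys = "us @ b # a # vs"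
  let ?t = "transpose (length us) (Suc (length us))"
  show "order_sign E ?ys = neg_one * (order_sign E ?xs :: 'f)"
  proof (cases "mset ?xs = mset (enum_of E)")
    case True
    then have ys: "mset (enum_of E) = mset ?ys" by (simp add: add_mset_commute)
    have "distinct ?xs"
      using enum_of[OF assms] True mset_eq_imp_distinct_iff by blast
    have "distinct ?ys" using \<open>distinct ?xs\<close> by auto
    obtain q where q: "q permutes {..<length ?ys}" "permute_list q ?ys = enum_of E"
      using mset_eq_permutation[OF ys] by blast
    have q': "q permutes {..<length ?xs}" using q(1) by simp
    have t: "?t permutes {..<length ?xs}" by (rule transpose_permutes_adjacent)
    \<comment> \<open>The sorting permutations of the two lists differ by the transposition \<open>?t\<close>.\<close>
    have "permute_list (?t \<circ> q) ?xs = enum_of E"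
      by (subst permute_list_compose[OF q']) (simp only: permute_list_adjacent q)
    then have "sort_perm E ?xs = ?t \<circ> q"
      using sort_perm_eqI[OF \<open>distinct ?xs\<close>] permutes_compose[OF q' t] by blast
    moreover have "sort_perm E ?ys = q"
      using sort_perm_eqI[OF \<open>distinct ?ys\<close>] q by blast
    moreover have "permutation ?t" "permutation q"
      using t q' permutation_permutes by blast+
    ultimately have "order_sign E ?xs = neg_one * (order_sign E ?ys :: 'f)"
      using True ys by (simp add: order_sign_def sgn_elt_compose sgn_elt_transpose)
    then show ?thesis by simp
  next
    case False
    then show ?thesis by (simp add: order_sign_def add_mset_commute)
  qed
qed


section \<open>Grassmann-Pluecker functions and their bases\<close>

lemma
  assumes "gp_function E r \<phi>" and "\<phi> xs \<noteq> 0"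
  shows gp_support_distinct: "distinct xs"
    and gp_support_subset: "set xs \<subseteq> E"
    and gp_support_length: "length xs = r"
  using assms unfolding gp_function_def tuples_def by (blast, blast, blast)

lemma gp_relation:
  assumes "gp_function E r \<phi>" "set xs \<subseteq> E" "Suc (length xs) = r" "set ys \<subseteq> E" "length ys = Suc r"
  shows "(\<Sum>k\<le>r. emb (neg_one ^ k * \<phi> (omit k ys) * \<phi> (ys ! k # xs))) \<in> nullset"
  using assms unfolding gp_function_def tuples_def by blast

lemma alternating_gp:
  assumes "gp_function E r \<phi>"
  shows "alternating \<phi>"
  unfolding alternating_def
proof (intro allI)
  fix us vs :: "'a list" and a b
  let ?xs = "us @ a # b # vs" and ?ys = "us @ b # a # vs"
  show "\<phi> ?ys = neg_one * \<phi> ?xs"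
  proof (cases "?xs \<in> tuples E r")
    case True
    then have "\<phi> (permute_list (transpose (length us) (Suc (length us))) ?xs)
        = sgn_elt (transpose (length us) (Suc (length us))) * \<phi> ?xs"
      using assms transpose_permutes_adjacent[of us a b vs]
      unfolding gp_function_def tuples_def by blast
    then show ?thesis by (simp add: permute_list_adjacent sgn_elt_transpose)
  next
    case False
    moreover from False have "?ys \<notin> tuples E r" by (auto simp: tuples_def)
    ultimately show ?thesis using assms unfolding gp_function_def by simp
  qed
qed

lemma gp_nonzero_mset:
  assumes "gp_function E r \<phi>" "mset xs = mset ys"
  shows "\<phi> xs \<noteq> 0 \<longleftrightarrow> \<phi> ys \<noteq> 0"
proof (rule swap_invariant_mset[where g = "\<lambda>w. \<phi> w \<noteq> 0", OF _ assms(2)])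
  fix us vs a b
  show "(\<phi> (us @ b # a # vs) \<noteq> 0) = (\<phi> (us @ a # b # vs) \<noteq> 0)"
    using alternating_gp[OF assms(1)] unfolding alternating_def
    by (metis idyll_mult_eq_0_iff neg_one_nonzero)
qed

lemma length_omit: "k < length ys \<Longrightarrow> length (omit k ys) = length ys - 1"
  by (simp add: omit_def)

lemma set_omit: "set (omit k ys) \<subseteq> set ys"
  by (auto simp: omit_def dest: in_set_takeD in_set_dropD)

lemma omit_append_left: "k < length ys \<Longrightarrow> omit k (ys @ as) = omit k ys @ as"
  by (simp add: omit_def)

lemma omit_append_right: "length ys \<le> k \<Longrightarrow> omit k (ys @ as) = ys @ omit (k - length ys) as"
  by (simp add: omit_def Suc_diff_le)

definition represents :: "('e list \<Rightarrow> 'f::idyll) \<Rightarrow> ('e, 'f) fmatroid \<Rightarrow> bool" where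
  "represents \<phi> M \<longleftrightarrow>
     finite (ground M) \<and> gp_function (ground M) (rk M) \<phi> \<and> gps M = gp_class \<phi>"

lemma F_matroid_iff_represents: "F_matroid M \<longleftrightarrow> (\<exists>\<phi>. represents \<phi> M)"
  by (auto simp: F_matroid_def represents_def)

lemma bases_iff:
  assumes "represents \<phi> M"
  shows "B \<in> bases M \<longleftrightarrow> (\<exists>xs. \<phi> xs \<noteq> 0 \<and> set xs = B)"
  using assms unfolding represents_def bases_def gp_class_def
  by (auto; metis mult_1 zero_neq_one)

lemma basis_card:
  assumes "represents \<phi> M" "B \<in> bases M"
  shows "card B = rk M" "B \<subseteq> ground M" "finite B"
  using assms gp_support_distinct gp_support_length gp_support_subset
  unfolding bases_iff[OF assms(1)] represents_def
  by (metis distinct_card, metis, metis List.finite_set)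

lemma basis_list:
  assumes "represents \<phi> M" "set xs \<in> bases M" "distinct xs"
  shows "\<phi> xs \<noteq> 0"
proof -
  obtain ys where ys: "\<phi> ys \<noteq> 0" "set ys = set xs" using assms bases_iff by metis
  have gp: "gp_function (ground M) (rk M) \<phi>" using assms(1) by (simp add: represents_def)
  have "mset ys = mset xs"
    using ys assms(3) gp_support_distinct[OF gp] set_eq_iff_mset_eq_distinct by blast
  then show ?thesis using gp_nonzero_mset[OF gp] ys by blast
qed

text \<open>
  In the Pluecker relation for \<open>f, B2\<close> and \<open>B1 - {f}\<close>, the term of index \<open>0\<close> is \<open>\<phi>(B2) \<phi>(B1) \<noteq> 0\<close>. A
  single unit is never null, so some other term is nonzero, and it names the element \<open>e\<close>.
\<close>

lemma basis_exchange:
  assumes M: "represents \<phi> M" and B: "B1 \<in> bases M" "B2 \<in> bases M" and f: "f \<in> B1 - B2"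
  shows "\<exists>e\<in>B2 - B1. insert e (B1 - {f}) \<in> bases M"
proof -
  have gp: "gp_function (ground M) (rk M) \<phi>" using M by (simp add: represents_def)
  obtain us where us: "distinct us" "set us = B1 - {f}"
    using basis_card(3)[OF M B(1)] by (metis finite_Diff finite_distinct_list)
  have fus: "\<phi> (f # us) \<noteq> 0"
    using basis_list[OF M, of "f # us"] us f B(1) by (simp add: insert_absorb)
  obtain vs where vs: "\<phi> vs \<noteq> 0" "set vs = B2" using B(2) bases_iff[OF M] by auto
  let ?T = "\<lambda>k. emb (neg_one ^ k * \<phi> (omit k (f # vs)) * \<phi> ((f # vs) ! k # us))"
  have "(\<Sum>k\<le>rk M. ?T k) \<in> nullset"
    using gp_relation[OF gp, of us "f # vs"] gp_support_length[OF gp fus]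
      gp_support_subset[OF gp fus] gp_support_length[OF gp vs(1)] gp_support_subset[OF gp vs(1)]
    by auto
  moreover have "?T 0 = {#\<phi> vs * \<phi> (f # us)#}"
    using fus vs by (simp add: emb_def omit_def)
  moreover have "{#\<phi> vs * \<phi> (f # us)#} \<notin> nullset"
    using fus vs by (intro singleton_notin_nullset) simp
  moreover have "(\<Sum>k\<le>rk M. ?T k) = ?T 0 + (\<Sum>k\<in>{..rk M} - {0}. ?T k)"
    by (subst sum.remove[of _ 0]) auto
  ultimately have "(\<Sum>k\<in>{..rk M} - {0}. ?T k) \<noteq> {#}" by auto
  then obtain k where k: "k \<in> {..rk M} - {0}" "?T k \<noteq> {#}"
    by (meson sum.neutral)
  then obtain j where j: "k = Suc j" by (cases k) auto
  then have eus: "\<phi> (vs ! j # us) \<noteq> 0" "vs ! j \<in> B2"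
    using k gp_support_length[OF gp vs(1)] vs(2) by (auto simp: emb_def)
  have "vs ! j \<notin> set us" using gp_support_distinct[OF gp eus(1)] by simp
  then have "vs ! j \<in> B2 - B1" using eus(2) us f by auto
  moreover have "insert (vs ! j) (B1 - {f}) \<in> bases M"
    using eus us bases_iff[OF M] by (metis list.simps(15))
  ultimately show ?thesis by blast
qed

text \<open>
  A basis whose intersection with \<open>D\<close> cannot be enlarged by one exchange meets \<open>D\<close> in as many
  elements as possible. Elements of \<open>B1 - D\<close> outside \<open>B2\<close> can be exchanged for elements of \<open>B2\<close>, which
  does not shrink \<open>B1 \<inter> D\<close>. Once \<open>B1 - D \<subseteq> B2\<close>, a basis \<open>B1\<close> with larger intersection would leave
  an element of \<open>B2 - D\<close> outside \<open>B1\<close>, and exchanging that one would enlarge \<open>B2 \<inter> D\<close>.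
\<close>

lemma basis_meet_card_le:
  assumes M: "represents \<phi> M" and B2: "B2 \<in> bases M"
    and max: "\<And>e f. e \<in> D - B2 \<Longrightarrow> f \<in> B2 - D \<Longrightarrow> insert e (B2 - {f}) \<notin> bases M"
    and "B1 \<in> bases M"
  shows "card (B1 \<inter> D) \<le> card (B2 \<inter> D)"
  using \<open>B1 \<in> bases M\<close>
proof (induction "card (B1 - D - B2)" arbitrary: B1 rule: less_induct)
  case less
  note fin = basis_card(3)[OF M less.prems] basis_card(3)[OF M B2]
  show ?case
  proof (cases "B1 - D \<subseteq> B2")
    case False
    then obtain f where f: "f \<in> B1" "f \<notin> D" "f \<notin> B2" by blast
    then obtain e where e: "e \<in> B2 - B1" "insert e (B1 - {f}) \<in> bases M"
      using basis_exchange[OF M less.prems B2] by blast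
    let ?B = "insert e (B1 - {f})"
    have "?B - D - B2 = (B1 - D - B2) - {f}" using e by blast
    then have "card (?B - D - B2) < card (B1 - D - B2)"
      using f fin by (metis DiffI card_Diff1_less finite_Diff)
    then have "card (?B \<inter> D) \<le> card (B2 \<inter> D)" using less.hyps e by blast
    moreover have "B1 \<inter> D \<subseteq> ?B \<inter> D" "finite (?B \<inter> D)" using f fin by blast+
    then have "card (B1 \<inter> D) \<le> card (?B \<inter> D)" by (rule card_mono[rotated])
    ultimately show ?thesis by simp
  next
    case True
    show ?thesis
    proof (rule ccontr)
      assume less_card: "\<not> card (B1 \<inter> D) \<le> card (B2 \<inter> D)"
      have "card (B1 - D) + card (B1 \<inter> D) = card (B2 - D) + card (B2 \<inter> D)"
        using basis_card(1)[OF M less.prems] basis_card(1)[OF M B2] fin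
        by (metis card_Diff_subset_Int card_mono finite_Int inf_le1 le_add_diff_inverse2)
      then have "card (B1 - D) < card (B2 - D)" using less_card by linarith
      then have "\<not> B2 - D \<subseteq> B1 - D" using fin by (meson card_mono finite_Diff leD)
      then obtain f where f: "f \<in> B2 - D" "f \<notin> B1" by blast
      then obtain e where e: "e \<in> B1 - B2" "insert e (B2 - {f}) \<in> bases M"
        using basis_exchange[OF M B2 less.prems] by blast
      then have "e \<in> D - B2" using True by blast
      then show False using max f e by blast
    qed
  qed
qed

text \<open>
  If \<open>B2\<close> is a basis containing the maximal set \<open>I\<close>, then \<open>I = B2 \<inter> D\<close>, and an exchange that enlarges
  \<open>B2 \<inter> D\<close> would contradict the maximality of \<open>I\<close>.
\<close>

lemma indep_card_le_max_indep:
  assumes M: "represents \<phi> M" and I: "max_indep_in M D I" and J: "J \<subseteq> D" "indep M J"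
  shows "card J \<le> card I"
proof -
  obtain B2 where B2: "B2 \<in> bases M" "I \<subseteq> B2"
    using I unfolding max_indep_in_def indep_def by blast
  then have I_eq: "I = B2 \<inter> D"
    using I unfolding max_indep_in_def indep_def by blast
  obtain B1 where B1: "B1 \<in> bases M" "J \<subseteq> B1" using J unfolding indep_def by blast
  have "card J \<le> card (B1 \<inter> D)"
    using B1 J basis_card(3)[OF M B1(1)] by (intro card_mono) auto
  also have "\<dots> \<le> card (B2 \<inter> D)"
  proof (rule basis_meet_card_le[OF M B2(1) _ B1(1)])
    fix e f assume e: "e \<in> D - B2" and f: "f \<in> B2 - D"
    show "insert e (B2 - {f}) \<notin> bases M"
    proof
      assume "insert e (B2 - {f}) \<in> bases M"
      moreover have "insert e I \<subseteq> insert e (B2 - {f})" using I_eq f by auto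
      ultimately have "indep M (insert e I)" unfolding indep_def by (rule rev_bexI)
      moreover have "I \<subseteq> insert e I" "insert e I \<subseteq> D" using I_eq e by auto
      ultimately have "insert e I = I" using I unfolding max_indep_in_def by metis
      then show False using e I_eq by blast
    qed
  qed
  finally show ?thesis using I_eq by simp
qed



section \<open>Vectors and covectors through a Grassmann-Pluecker function\<close>

text \<open>
  The sign computation behind the description of cocircuits by \<open>\<phi>\<close>: up to a constant that does not
  depend on \<open>i\<close>, the values of a circuit of the dual are \<open>\<phi>(y\<^sub>i, z\<^sub>2, \<dots>, z\<^sub>r)\<close>, where the \<open>z\<close> enumerate the
  complement of the \<open>y\<close>. The factor \<open>(-1)\<^sup>i\<close> is compensated by moving \<open>y\<^sub>i\<close> past the
  entries \<open>y\<^sub>j\<close> with \<open>j > i\<close>, whose number is \<open>card E - r - i\<close>.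
\<close>

lemma dual_gp_eq_cofactor:
  fixes \<phi> :: "'e list \<Rightarrow> 'f::idyll"
  assumes M: "finite E" "gp_function E r \<phi>"
    and ys: "set ys \<subseteq> E" "distinct ys" "length ys = Suc (card E - r)"
    and zs: "distinct zs" "set zs = E - set ys" and i: "i \<le> card E - r"
  shows "neg_one ^ i * dual_gp E r \<phi> (omit i ys)
    = neg_one ^ (card E - r) * order_sign E (ys @ zs) * \<phi> (ys ! i # zs)"
proof -
  let ?us = "take i ys" and ?y = "ys ! i" and ?vs = "drop (Suc i) ys"
  have ys_split: "ys = ?us @ ?y # ?vs" using i ys(3) by (simp add: id_take_nth_drop)
  have omit: "omit i ys = ?us @ ?vs" by (simp add: omit_def)
  have set_ys: "set ys = insert ?y (set (?us @ ?vs))" by (subst ys_split) simp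
  have dist: "distinct (?us @ ?vs)" "?y \<notin> set (?us @ ?vs)"
    using ys(2) by (subst (asm) ys_split, simp)+
  define xs where "xs = filter (\<lambda>e. e \<notin> set (omit i ys)) (enum_of E)"
  have "distinct xs" "set xs = E - set (omit i ys)" using enum_of[OF M(1)] by (auto simp: xs_def)
  moreover have "set (?y # zs) = E - set (omit i ys)" "distinct (?y # zs)"
    using zs set_ys ys(1) dist omit by auto
  ultimately have mset_xs: "mset xs = mset (?y # zs)"
    using set_eq_iff_mset_eq_distinct by blast
  have dist_all: "distinct (omit i ys @ xs)" "set (omit i ys @ xs) = E"
    using dist omit \<open>distinct xs\<close> \<open>set xs = _\<close> set_ys ys(1) by auto
  then have mset_all: "mset (omit i ys @ xs) = mset (enum_of E)"
    using enum_of[OF M(1)] set_eq_iff_mset_eq_distinct by metis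
  have "omit i ys \<in> tuples E (card E - r)"
    using ys i set_omit[of i ys] length_omit[of i ys] by (auto simp: tuples_def)
  then have "dual_gp E r \<phi> (omit i ys) = order_sign E (omit i ys @ xs) * \<phi> xs"
    using dist omit mset_all by (simp add: dual_gp_def xs_def Let_def order_sign_def)
  \<comment> \<open>Both factors alternate in \<open>w\<close>, so their product may be evaluated at any ordering of the complement.\<close>
  also have "\<dots> = order_sign E (omit i ys @ ?y # zs) * \<phi> (?y # zs)"
  proof (rule swap_invariant_mset[where g = "\<lambda>w. order_sign E (omit i ys @ w) * \<phi> w", OF _ mset_xs])
    fix us vs :: "'e list" and a b
    have "order_sign E ((omit i ys @ us) @ b # a # vs)
        = neg_one * (order_sign E ((omit i ys @ us) @ a # b # vs) :: 'f)"
      using alternating_order_sign[OF M(1)] unfolding alternating_def by blast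
    moreover have "\<phi> (us @ b # a # vs) = neg_one * \<phi> (us @ a # b # vs)"
      using alternating_gp[OF M(2)] unfolding alternating_def by blast
    ultimately show "order_sign E (omit i ys @ us @ b # a # vs) * \<phi> (us @ b # a # vs)
        = order_sign E (omit i ys @ us @ a # b # vs) * \<phi> (us @ a # b # vs)"
      by (simp add: mult_ac)
  qed
  also have "order_sign E (omit i ys @ ?y # zs)
      = neg_one ^ length ?vs * (order_sign E (?us @ ?y # ?vs @ zs) :: 'f)"
    using alternating_move[OF alternating_order_sign[OF M(1)], of ?us ?vs ?y zs] omit by simp
  also have "?us @ ?y # ?vs @ zs = ys @ zs" by (subst (4) ys_split) simp
  finally have "neg_one ^ i * dual_gp E r \<phi> (omit i ys)
      = neg_one ^ i * neg_one ^ length ?vs * order_sign E (ys @ zs) * \<phi> (?y # zs)"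
    by (simp add: mult.assoc)
  moreover have "neg_one ^ i * neg_one ^ length ?vs = (neg_one ^ (card E - r) :: 'f)"
  proof -
    have "i + length ?vs = card E - r" using ys(3) i by simp
    then show ?thesis by (metis power_add)
  qed
  ultimately show ?thesis by simp
qed

lemma gp_rank_le_card:
  assumes "finite E" "gp_function E r \<phi>"
  shows "r \<le> card E"
proof -
  obtain xs where xs: "\<phi> xs \<noteq> 0" using assms(2) unfolding gp_function_def by blast
  show ?thesis
    using card_mono[OF assms(1) gp_support_subset[OF assms(2) xs]]
      distinct_card[OF gp_support_distinct[OF assms(2) xs]] gp_support_length[OF assms(2) xs]
    by simp
qed

lemma gps_iff:
  assumes "represents \<phi> M"
  shows "\<psi> \<in> gps M \<longleftrightarrow> (\<exists>a. a \<noteq> 0 \<and> \<psi> = (\<lambda>xs. a * \<phi> xs))"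
  using assms by (auto simp: represents_def gp_class_def)

lemma dual_gp_scale: "dual_gp E r (\<lambda>xs. a * \<phi> xs) xs = a * dual_gp E r \<phi> xs"
  by (simp add: dual_gp_def Let_def mult_ac)

text \<open>
  A circuit of the dual lives on a list \<open>ys\<close> of \<open>card E - r + 1\<close> elements, so its complement \<open>zs\<close> has
  \<open>r - 1\<close> elements. In rank \<open>0\<close> there is no room for such a list and there are no cocircuits.
  On \<open>zs\<close> itself both sides vanish.
\<close>

lemma cocircuit_eq_cofactor:
  assumes M: "represents \<phi> M" and Y: "Y \<in> cocircuits M"
  obtains a zs where "set zs \<subseteq> ground M" "Suc (length zs) = rk M"
    "\<And>e. e \<in> ground M \<Longrightarrow> Y e = a * \<phi> (e # zs)"
proof -
  let ?E = "ground M" and ?r = "rk M"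
  have gp: "finite ?E" "gp_function ?E ?r \<phi>" using M by (auto simp: represents_def)
  obtain \<psi> ys c where \<psi>: "\<psi> \<in> gps M" and ys: "ys \<in> tuples ?E (Suc (card ?E - ?r))" "distinct ys"
    and c: "c \<noteq> 0"
    and Y_in: "\<And>i. i \<le> card ?E - ?r \<Longrightarrow> Y (ys ! i) = c * (neg_one ^ i * dual_gp ?E ?r \<psi> (omit i ys))"
    and Y_out: "\<And>e. e \<notin> set ys \<Longrightarrow> Y e = 0"
    using Y unfolding cocircuits_def circuits_def dual_def by auto
  obtain b where b: "b \<noteq> 0" "\<psi> = (\<lambda>xs. b * \<phi> xs)" using gps_iff[OF M] \<psi> by blast
  have ys': "set ys \<subseteq> ?E" "length ys = Suc (card ?E - ?r)" using ys by (auto simp: tuples_def)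
  obtain zs where zs: "distinct zs" "set zs = ?E - set ys"
    using gp(1) by (metis finite_Diff finite_distinct_list)
  have "length zs = card ?E - Suc (card ?E - ?r)"
    using zs ys ys' gp(1) by (metis List.finite_set card_Diff_subset distinct_card)
  moreover have "Suc (card ?E - ?r) \<le> card ?E"
    using ys ys' gp(1) by (metis card_mono distinct_card)
  ultimately have len: "Suc (length zs) = ?r" using gp_rank_le_card[OF gp] by linarith
  let ?a = "c * (b * (neg_one ^ (card ?E - ?r) * order_sign ?E (ys @ zs)))"
  have "Y e = ?a * \<phi> (e # zs)" if "e \<in> ?E" for e
  proof (cases "e \<in> set ys")
    case True
    then obtain i where i: "i \<le> card ?E - ?r" "e = ys ! i"
      using ys'(2) by (metis in_set_conv_nth less_Suc_eq_le)
    then show ?thesis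
      using Y_in[OF i(1)] dual_gp_eq_cofactor[OF gp ys'(1) ys(2) ys'(2) zs i(1)]
      by (simp add: b(2) dual_gp_scale mult_ac)
  next
    case False
    then have "\<not> distinct (e # zs)" using that zs by simp
    then show ?thesis using Y_out[OF False] gp_support_distinct[OF gp(2)] by fastforce
  qed
  moreover have "set zs \<subseteq> ?E" using zs by blast
  ultimately show ?thesis using that len by blast
qed

text \<open>
  The converse: the circuit of the dual on an enumeration \<open>ys\<close> of the complement of \<open>zs\<close>. The
  nonvanishing makes \<open>zs\<close> free of repetitions and gives the nonzero entry that a circuit must have.
\<close>

lemma cofactor_cocircuit:
  assumes M: "represents \<phi> M" and len: "Suc (length zs) = rk M" and nonzero: "\<phi> (e # zs) \<noteq> 0"
  obtains a Y where "a \<noteq> 0" "Y \<in> cocircuits M" "\<And>e. e \<in> ground M \<Longrightarrow> Y e = a * \<phi> (e # zs)"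
proof -
  let ?E = "ground M" and ?r = "rk M"
  have gp: "finite ?E" "gp_function ?E ?r \<phi>" using M by (auto simp: represents_def)
  note supp = gp_support_distinct[OF gp(2) nonzero] gp_support_subset[OF gp(2) nonzero]
  obtain ys where ys: "distinct ys" "set ys = ?E - set zs"
    using gp(1) by (metis finite_Diff finite_distinct_list)
  have "length ys = card ?E - length zs"
    using ys supp gp(1) by (metis card_Diff_subset distinct.simps(2) distinct_card finite_set
        list.set_intros(2) subset_code(1))
  then have len_ys: "length ys = Suc (card ?E - ?r)" using len gp_rank_le_card[OF gp] by linarith
  have zs: "distinct zs" "set zs = ?E - set ys" using supp ys by auto
  let ?a = "neg_one ^ (card ?E - ?r) * order_sign ?E (ys @ zs)"
  let ?Y = "\<lambda>e. if e \<in> ?E then ?a * \<phi> (e # zs) else 0"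
  have "mset (ys @ zs) = mset (enum_of ?E)"
    using enum_of[OF gp(1)] zs ys supp set_eq_iff_mset_eq_distinct[of "ys @ zs" "enum_of ?E"] by auto
  then have a: "?a \<noteq> 0" by (simp add: order_sign_def)
  have cofactor: "?Y (ys ! i) = neg_one ^ i * dual_gp ?E ?r \<phi> (omit i ys)" if "i \<le> card ?E - ?r" for i
    using dual_gp_eq_cofactor[OF gp _ ys(1) len_ys zs that] ys len_ys that
    by (metis Diff_iff Diff_subset less_Suc_eq_le nth_mem)
  have "\<phi> \<in> gps M" using gps_iff[OF M] by (metis (no_types, lifting) ext mult_1 zero_neq_one)
  have "e \<in> set ys" using supp ys by auto
  then obtain k where k: "k \<le> card ?E - ?r" "ys ! k = e"
    using len_ys by (metis in_set_conv_nth less_Suc_eq_le)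
  then have "dual_gp ?E ?r \<phi> (omit k ys) \<noteq> 0"
    using cofactor[OF k(1)] a nonzero supp
    by (metis idyll_mult_eq_0_iff list.set_intros(1) subset_iff)
  moreover have "?Y x = 0" if "x \<notin> set ys" for x
  proof -
    have "\<not> distinct (x # zs)" if "x \<in> ?E" using that \<open>x \<notin> set ys\<close> ys by simp
    then show ?thesis using gp_support_distinct[OF gp(2)] by fastforce
  qed
  moreover have "ys \<in> tuples ?E (Suc (card ?E - ?r))" using ys len_ys by (auto simp: tuples_def)
  ultimately have "?Y \<in> cocircuits M"
    unfolding cocircuits_def circuits_def dual_def fmatroid.simps mem_Collect_eq
    using \<open>\<phi> \<in> gps M\<close> cofactor k(1) ys(1)
    by (intro bexI[of _ "dual_gp ?E ?r \<phi>"] bexI[of _ ys] exI[of _ 1]) auto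
  then show ?thesis using that[OF a] by simp
qed

text \<open>
  Identically vanishing functions \<open>e \<mapsto> \<phi>(e, z\<^sub>2, \<dots>, z\<^sub>r)\<close> may be included, although they are not
  cocircuits, because they are orthogonal to everything.
\<close>

lemma vectors_iff:
  assumes M: "represents \<phi> M"
  shows "X \<in> vectors M \<longleftrightarrow> X \<in> vects (ground M) \<and>
    (\<forall>zs. set zs \<subseteq> ground M \<longrightarrow> Suc (length zs) = rk M \<longrightarrow>
      (\<Sum>e\<in>ground M. emb (X e * \<phi> (e # zs))) \<in> nullset)"
    (is "_ \<longleftrightarrow> _ \<and> ?R")
proof -
  have "(\<forall>Y\<in>cocircuits M. orth (ground M) X Y) \<longleftrightarrow> ?R"
  proof (intro iffI ballI allI impI)
    fix zs assume L: "\<forall>Y\<in>cocircuits M. orth (ground M) X Y"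
      and zs: "set zs \<subseteq> ground M" "Suc (length zs) = rk M"
    show "(\<Sum>e\<in>ground M. emb (X e * \<phi> (e # zs))) \<in> nullset"
    proof (cases "\<forall>e. \<phi> (e # zs) = 0")
      case True
      then show ?thesis by (simp add: nullset_zero)
    next
      case False
      then obtain e where "\<phi> (e # zs) \<noteq> 0" by blast
      then obtain a Y where Y: "a \<noteq> 0" "Y \<in> cocircuits M"
        "\<And>e. e \<in> ground M \<Longrightarrow> Y e = a * \<phi> (e # zs)"
        using cofactor_cocircuit[OF M zs(2)] by metis
      obtain b where b: "a * b = 1" using unit_ex Y(1) by blast
      have "(\<Sum>e\<in>ground M. emb (X e * Y e)) \<in> nullset" using L Y(2) unfolding orth_def by blast
      from nullset_scale[OF this, of b]
      have "(\<Sum>e\<in>ground M. emb (b * (X e * Y e))) \<in> nullset" .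
      moreover have "b * (X e * Y e) = X e * \<phi> (e # zs)" if "e \<in> ground M" for e
      proof -
        have "b * (X e * Y e) = (a * b) * (X e * \<phi> (e # zs))" using Y(3)[OF that] by (simp add: mult_ac)
        then show ?thesis using b by simp
      qed
      ultimately show ?thesis by simp
    qed
  next
    fix Y assume R: ?R and "Y \<in> cocircuits M"
    then obtain a zs where zs: "set zs \<subseteq> ground M" "Suc (length zs) = rk M"
      and Y: "\<And>e. e \<in> ground M \<Longrightarrow> Y e = a * \<phi> (e # zs)"
      using cocircuit_eq_cofactor[OF M] by metis
    have "(\<Sum>e\<in>ground M. emb (X e * \<phi> (e # zs))) \<in> nullset" using R zs by blast
    from nullset_scale[OF this, of a] show "orth (ground M) X Y"
      using Y by (simp add: orth_def mult_ac)
  qed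
  then show ?thesis by (auto simp: vectors_def)
qed

lemma circuit_sum:
  assumes "finite E" "set ys \<subseteq> E" "distinct ys" "length ys = Suc r"
    and "\<And>e. e \<notin> set ys \<Longrightarrow> Z e = 0"
  shows "(\<Sum>e\<in>E. emb (X e * Z e)) = (\<Sum>i\<le>r. emb (X (ys ! i) * Z (ys ! i)))"
proof -
  have "(\<Sum>e\<in>E. emb (X e * Z e)) = (\<Sum>e\<in>set ys. emb (X e * Z e))"
    using assms by (intro sum.mono_neutral_right) auto
  also have "\<dots> = (\<Sum>i\<le>r. emb (X (ys ! i) * Z (ys ! i)))"
    using bij_betw_nth[OF assms(3), of "{..r}" "set ys"] assms(4)
    by (intro sum.reindex_bij_betw[symmetric]) (auto simp: lessThan_Suc_atMost)
  finally show ?thesis .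
qed

lemma covectors_iff:
  assumes M: "represents \<phi> M"
  shows "X \<in> covectors M \<longleftrightarrow> X \<in> vects (ground M) \<and>
    (\<forall>ys. set ys \<subseteq> ground M \<longrightarrow> distinct ys \<longrightarrow> length ys = Suc (rk M) \<longrightarrow>
      (\<Sum>i\<le>rk M. emb (X (ys ! i) * (neg_one ^ i * \<phi> (omit i ys)))) \<in> nullset)"
    (is "_ \<longleftrightarrow> _ \<and> ?R")
proof -
  let ?E = "ground M" and ?r = "rk M"
  have gp: "finite ?E" "gp_function ?E ?r \<phi>" using M by (auto simp: represents_def)
  have \<phi>: "\<phi> \<in> gps M" using gps_iff[OF M] by (metis (no_types, lifting) ext mult_1 zero_neq_one)
  have "(\<forall>Z\<in>circuits M. orth ?E X Z) \<longleftrightarrow> ?R"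
  proof (intro iffI ballI allI impI)
    fix ys assume L: "\<forall>Z\<in>circuits M. orth ?E X Z"
      and ys: "set ys \<subseteq> ?E" "distinct ys" "length ys = Suc ?r"
    show "(\<Sum>i\<le>?r. emb (X (ys ! i) * (neg_one ^ i * \<phi> (omit i ys)))) \<in> nullset"
    proof (cases "\<forall>i\<le>?r. \<phi> (omit i ys) = 0")
      case True
      then show ?thesis by (simp add: nullset_zero)
    next
      case False
      \<comment> \<open>The circuit \<open>X\<^sub>y\<close>; the description operator recovers the position of \<open>e\<close> in \<open>ys\<close>.\<close>
      define Z where "Z e = (if e \<in> set ys
        then let i = THE i. i \<le> ?r \<and> ys ! i = e in neg_one ^ i * \<phi> (omit i ys) else 0)" for e
      have Z: "Z (ys ! i) = neg_one ^ i * \<phi> (omit i ys)" if "i \<le> ?r" for i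
      proof -
        have "(THE j. j \<le> ?r \<and> ys ! j = ys ! i) = i"
          using that ys by (intro the_equality) (auto simp: nth_eq_iff_index_eq)
        then show ?thesis using that ys by (simp add: Z_def)
      qed
      have Z0: "Z e = 0" if "e \<notin> set ys" for e using that by (simp add: Z_def)
      have "Z \<in> circuits M"
        unfolding circuits_def mem_Collect_eq tuples_def
        using \<phi> ys False Z Z0 by (intro bexI[of _ \<phi>] bexI[of _ ys] exI[of _ 1]) auto
      then have "(\<Sum>e\<in>?E. emb (X e * Z e)) \<in> nullset" using L unfolding orth_def by blast
      then show ?thesis using circuit_sum[OF gp(1) ys, of Z X, OF Z0] Z by simp
    qed
  next
    fix Z assume R: ?R and "Z \<in> circuits M"
    then obtain \<psi> ys c where \<psi>: "\<psi> \<in> gps M" and ys: "set ys \<subseteq> ?E" "distinct ys" "length ys = Suc ?r"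
      and Z: "\<And>i. i \<le> ?r \<Longrightarrow> Z (ys ! i) = c * (neg_one ^ i * \<psi> (omit i ys))"
      and Z0: "\<And>e. e \<notin> set ys \<Longrightarrow> Z e = 0"
      unfolding circuits_def tuples_def by auto
    obtain b where b: "\<psi> = (\<lambda>xs. b * \<phi> xs)" using gps_iff[OF M] \<psi> by blast
    have "(\<Sum>i\<le>?r. emb (X (ys ! i) * (neg_one ^ i * \<phi> (omit i ys)))) \<in> nullset" using R ys by blast
    from nullset_scale[OF this, of "c * b"] show "orth ?E X Z"
      using Z circuit_sum[OF gp(1) ys, of Z X, OF Z0] by (simp add: orth_def b mult_ac)
  qed
  then show ?thesis by (auto simp: covectors_def)
qed

text \<open>
  Orthogonality of \<open>X\<^sub>y\<close> and \<open>e \<mapsto> \<phi>(e, z\<^sub>2, \<dots>, z\<^sub>r)\<close> is the Pluecker relation for \<open>y\<close> and \<open>z\<close>.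
\<close>

lemma circuits_subset_vectors:
  assumes M: "represents \<phi> M"
  shows "circuits M \<subseteq> vectors M"
proof
  let ?E = "ground M" and ?r = "rk M"
  have gp: "finite ?E" "gp_function ?E ?r \<phi>" using M by (auto simp: represents_def)
  fix Z assume "Z \<in> circuits M"
  then obtain \<psi> ys c where \<psi>: "\<psi> \<in> gps M" and ys: "set ys \<subseteq> ?E" "distinct ys" "length ys = Suc ?r"
    and Z: "\<And>i. i \<le> ?r \<Longrightarrow> Z (ys ! i) = c * (neg_one ^ i * \<psi> (omit i ys))"
    and Z0: "\<And>e. e \<notin> set ys \<Longrightarrow> Z e = 0"
    unfolding circuits_def tuples_def by auto
  obtain b where b: "\<psi> = (\<lambda>xs. b * \<phi> xs)" using gps_iff[OF M] \<psi> by blast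
  have "(\<Sum>e\<in>?E. emb (Z e * \<phi> (e # zs))) \<in> nullset"
    if zs: "set zs \<subseteq> ?E" "Suc (length zs) = ?r" for zs
  proof -
    have "(\<Sum>e\<in>?E. emb (Z e * \<phi> (e # zs))) = (\<Sum>i\<le>?r. emb (\<phi> (ys ! i # zs) * Z (ys ! i)))"
      using circuit_sum[OF gp(1) ys, of Z "\<lambda>e. \<phi> (e # zs)", OF Z0] by (simp add: mult.commute)
    also have "\<dots> = (\<Sum>i\<le>?r. emb (c * b * (neg_one ^ i * \<phi> (omit i ys) * \<phi> (ys ! i # zs))))"
      using Z by (intro sum.cong) (auto simp: b mult_ac)
    also have "\<dots> \<in> nullset"
      by (rule nullset_scale[OF gp_relation[OF gp(2) zs ys(1,3)]])
    finally show ?thesis .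
  qed
  moreover have "Z \<in> vects ?E" using Z0 ys unfolding vects_def by blast
  ultimately show "Z \<in> vectors M" using vectors_iff[OF M] by blast
qed

section \<open>Perfection on arbitrary finite ground sets\<close>

text \<open>
  This covers both relabelling (\<open>as\<close> empty) and minors (\<open>h\<close> the identity). In the Pluecker relation
  for \<open>ys @ as\<close> and \<open>xs @ as\<close>, a term that moves an entry of \<open>as\<close> has a repeated argument and
  vanishes, and the remaining terms form the relation for \<open>ys\<close> and \<open>xs\<close>.
\<close>

lemma gp_function_pullback:
  assumes gp: "gp_function E r \<phi>" and h: "h ` E' \<subseteq> E" and as: "set as \<subseteq> E" "k + length as = r"
    and xs0: "set xs0 \<subseteq> E'" "\<phi> (map h xs0 @ as) \<noteq> 0"
  shows "gp_function E' k (\<lambda>xs. if xs \<in> tuples E' k then \<phi> (map h xs @ as) else 0)"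
    (is "gp_function E' k ?\<psi>")
proof -
  have \<psi>: "?\<psi> xs = \<phi> (map h xs @ as)" if "set xs \<subseteq> E'" for xs
  proof (cases "length xs = k")
    case False
    then have "length (map h xs @ as) \<noteq> r" using as by simp
    then have "\<phi> (map h xs @ as) = 0" using gp_support_length[OF gp] by blast
    then show ?thesis using False by (simp add: tuples_def)
  qed (use that in \<open>simp add: tuples_def\<close>)
  have nonzero: "?\<psi> xs0 \<noteq> 0" using \<psi> xs0 by simp
  have alternates: "?\<psi> (permute_list p xs) = sgn_elt p * ?\<psi> xs"
    if xs: "xs \<in> tuples E' k" and p: "p permutes {..<k}" for xs p
  proof -
    have len: "length xs = k" "set xs \<subseteq> E'" using xs by (auto simp: tuples_def)
    have p': "p permutes {..<r}" by (rule permutes_subset[OF p]) (use as in auto)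
    have "permute_list p (map h xs @ as) = map h (permute_list p xs) @ as"
    proof (rule nth_equalityI)
      fix i assume "i < length (permute_list p (map h xs @ as))"
      then have i: "i < length (map h xs @ as)" by simp
      have "p i < k" if "i < k" using permutes_in_image[OF p, of i] that by simp
      moreover have "p i = i" if "\<not> i < k" using p that unfolding permutes_def by simp
      ultimately show "permute_list p (map h xs @ as) ! i = (map h (permute_list p xs) @ as) ! i"
        using i len as p p' by (subst permute_list_nth)
          (auto simp: nth_append permute_list_nth)
    qed simp
    moreover have "map h xs @ as \<in> tuples E r" using h as len by (auto simp: tuples_def)
    then have "\<phi> (permute_list p (map h xs @ as)) = sgn_elt p * \<phi> (map h xs @ as)"
      using gp p' unfolding gp_function_def by blast
    moreover have "set (permute_list p xs) \<subseteq> E'" using p len by simp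
    ultimately show ?thesis unfolding \<psi>[OF len(2)] \<psi>[OF \<open>set (permute_list p xs) \<subseteq> E'\<close>] by simp
  qed
  have repeated: "?\<psi> xs = 0" if "\<not> distinct xs" for xs
    using that gp_support_distinct[OF gp, of "map h xs @ as"] by (auto simp: distinct_map)
  have relation: "(\<Sum>i\<le>k. emb (neg_one ^ i * ?\<psi> (omit i ys) * ?\<psi> (ys ! i # xs))) \<in> nullset"
    if xs: "set xs \<subseteq> E'" "Suc (length xs) = k" and ys: "set ys \<subseteq> E'" "length ys = Suc k" for xs ys
  proof -
    let ?T = "\<lambda>i. emb (neg_one ^ i * \<phi> (omit i (map h ys @ as)) * \<phi> ((map h ys @ as) ! i # map h xs @ as))"
    have "(\<Sum>i\<le>r. ?T i) \<in> nullset"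
    proof (rule gp_relation[OF gp])
      show "set (map h xs @ as) \<subseteq> E" "set (map h ys @ as) \<subseteq> E"
        using h as(1) xs(1) ys(1) by (auto simp: image_subset_iff subset_iff)
    qed (use as xs ys in auto)
    moreover have "(\<Sum>i\<le>r. ?T i) = (\<Sum>i\<le>k. ?T i)"
    proof (rule sum.mono_neutral_right)
      show "\<forall>i\<in>{..r} - {..k}. ?T i = {#}"
      proof
        fix i assume "i \<in> {..r} - {..k}"
        then have "(map h ys @ as) ! i \<in> set as" using ys as by (auto simp: nth_append)
        then have "\<not> distinct ((map h ys @ as) ! i # map h xs @ as)" by simp
        then have "\<phi> ((map h ys @ as) ! i # map h xs @ as) = 0" using gp_support_distinct[OF gp] by blast
        then show "?T i = {#}" by simp
      qed
    qed (use as in auto)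
    moreover have "?T i = emb (neg_one ^ i * ?\<psi> (omit i ys) * ?\<psi> (ys ! i # xs))" if "i \<le> k" for i
    proof -
      have "omit i (map h ys @ as) = map h (omit i ys) @ as"
        using that ys by (simp add: omit_def take_map drop_map)
      moreover have "(map h ys @ as) ! i # map h xs @ as = map h (ys ! i # xs) @ as"
        using that ys by (simp add: nth_append)
      moreover have omit: "set (omit i ys) \<subseteq> E'" using set_omit[of i ys] ys(1) by (rule subset_trans)
      moreover have cons: "set (ys ! i # xs) \<subseteq> E'" using that xs ys nth_mem[of i ys] by auto
      ultimately show ?thesis unfolding \<psi>[OF omit] \<psi>[OF cons] by simp
    qed
    ultimately show ?thesis by simp
  qed
  show ?thesis
    unfolding gp_function_def
  proof (intro conjI allI ballI impI)
    show "\<exists>xs. ?\<psi> xs \<noteq> 0" using nonzero by (rule exI)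
  next
    fix xs ys assume "set xs \<subseteq> E' \<and> Suc (length xs) = k \<and> ys \<in> tuples E' (Suc k)"
    then show "(\<Sum>i\<le>k. emb (neg_one ^ i * ?\<psi> (omit i ys) * ?\<psi> (ys ! i # xs))) \<in> nullset"
      by (intro relation) (auto simp: tuples_def)
  qed (simp, rule alternates, assumption+, rule repeated)
qed

text \<open>
  The matroid is transported along an enumeration of its ground set. Since vectors and covectors are
  characterised by sums over the ground set, they are transported too, and so is orthogonality.
\<close>

lemma perfect_orth:
  fixes M :: "('e, 'f::idyll) fmatroid"
  assumes perfect: "perfect_idyll TYPE('f)" and M: "represents \<phi> M"
    and X: "X \<in> vectors M" and Y: "Y \<in> covectors M"
  shows "orth (ground M) X Y"
proof -
  let ?E = "ground M" and ?r = "rk M" and ?I = "{0..<card (ground M)}"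
  have gp: "finite ?E" "gp_function ?E ?r \<phi>" using M by (auto simp: represents_def)
  obtain h where h: "bij_betw h ?I ?E" using ex_bij_betw_nat_finite[OF gp(1)] by blast
  then have inj: "inj_on h ?I" and img: "h ` ?I = ?E" by (auto simp: bij_betw_def)
  define \<psi> where "\<psi> = (\<lambda>xs. if xs \<in> tuples ?I ?r then \<phi> (map h xs @ []) else 0)"
  obtain xs where xs: "\<phi> xs \<noteq> 0" using gp(2) unfolding gp_function_def by blast
  have "xs \<in> map h ` lists ?I"
    using gp_support_subset[OF gp(2) xs] unfolding lists_image[symmetric] img by (simp add: lists_eq_set)
  then obtain xs' where xs': "xs = map h xs'" "set xs' \<subseteq> ?I" by (auto simp: lists_eq_set)
  have gp': "gp_function ?I ?r \<psi>"
    unfolding \<psi>_def by (rule gp_function_pullback[OF gp(2) _ _ _ xs'(2)]) (use xs xs' img in auto)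
  have \<psi>: "\<psi> xs = \<phi> (map h xs)" if "set xs \<subseteq> ?I" "length xs = ?r" for xs
    using that by (simp add: \<psi>_def tuples_def)
  define M' where "M' = \<lparr>ground = ?I, rk = ?r, gps = gp_class \<psi>\<rparr>"
  have M': "represents \<psi> M'" "ground M' = ?I" "rk M' = ?r"
    using gp' by (simp_all add: M'_def represents_def)
  let ?pull = "\<lambda>Z n. if n \<in> ?I then Z (h n) else 0"
  have "?pull X \<in> vectors M'"
    unfolding vectors_iff[OF M'(1)] M'(2,3)
  proof (intro conjI allI impI)
    fix zs assume zs: "set zs \<subseteq> ?I" "Suc (length zs) = ?r"
    have "(\<Sum>n\<in>?I. emb (?pull X n * \<psi> (n # zs))) = (\<Sum>n\<in>?I. emb (X (h n) * \<phi> (h n # map h zs)))"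
      using zs \<psi> by (intro sum.cong) auto
    also have "\<dots> = (\<Sum>e\<in>?E. emb (X e * \<phi> (e # map h zs)))"
      by (rule sum.reindex_bij_betw[OF h])
    also have "\<dots> \<in> nullset"
    proof -
      have "set (map h zs) \<subseteq> ?E" "Suc (length (map h zs)) = ?r" using zs img by auto
      then show ?thesis using X unfolding vectors_iff[OF M] by blast
    qed
    finally show "(\<Sum>n\<in>?I. emb (?pull X n * \<psi> (n # zs))) \<in> nullset" .
  qed (simp add: vects_def)
  moreover have "?pull Y \<in> covectors M'"
    unfolding covectors_iff[OF M'(1)] M'(2,3)
  proof (intro conjI allI impI)
    fix ys assume ys: "set ys \<subseteq> ?I" "distinct ys" "length ys = Suc ?r"
    have "?pull Y (ys ! i) * (neg_one ^ i * \<psi> (omit i ys))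
        = Y (map h ys ! i) * (neg_one ^ i * \<phi> (omit i (map h ys)))" if "i \<le> ?r" for i
    proof -
      have i: "i < length ys" using that ys by simp
      then have "ys ! i \<in> ?I" using ys(1) nth_mem by blast
      moreover have "\<psi> (omit i ys) = \<phi> (map h (omit i ys))"
        using \<psi>[of "omit i ys"] set_omit[of i ys] length_omit[OF i] ys by auto
      ultimately show ?thesis using i by (simp add: omit_def take_map drop_map)
    qed
    moreover have "distinct (map h ys)" "set (map h ys) \<subseteq> ?E" "length (map h ys) = Suc ?r"
      using ys inj img by (auto simp: distinct_map intro: inj_on_subset)
    then have "(\<Sum>i\<le>?r. emb (Y (map h ys ! i) * (neg_one ^ i * \<phi> (omit i (map h ys))))) \<in> nullset"
      using Y unfolding covectors_iff[OF M] by blast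
    ultimately show "(\<Sum>i\<le>?r. emb (?pull Y (ys ! i) * (neg_one ^ i * \<psi> (omit i ys)))) \<in> nullset"
      by simp
  qed (simp add: vects_def)
  moreover have "F_matroid M'" using M'(1) F_matroid_iff_represents by blast
  ultimately have "orth ?I (?pull X) (?pull Y)"
    using perfect M'(2) unfolding perfect_idyll_def by metis
  then have "(\<Sum>n\<in>?I. emb (X (h n) * Y (h n))) \<in> nullset" by (simp add: orth_def)
  then show ?thesis
    using sum.reindex_bij_betw[OF h, of "\<lambda>e. emb (X e * Y e)"] by (simp add: orth_def)
qed


section \<open>Minors\<close>

definition extend_gp ::
    "'e set \<Rightarrow> nat \<Rightarrow> 'e list \<Rightarrow> ('e list \<Rightarrow> 'f::idyll) \<Rightarrow> 'e list \<Rightarrow> 'f" where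
  "extend_gp E k as \<phi> = (\<lambda>xs. if xs \<in> tuples E k then \<phi> (xs @ as) else 0)"

text \<open>
  Both contraction and deletion fix the last arguments of \<open>\<phi>\<close>; only the choice of the fixed list differs.
\<close>

lemma represents_extend_gp:
  assumes M: "represents \<phi> M" and E: "E \<subseteq> ground M" and as: "set as \<subseteq> ground M" "k + length as = rk M"
    and xs: "set xs \<subseteq> E" "\<phi> (xs @ as) \<noteq> 0"
  shows "represents (extend_gp E k as \<phi>) \<lparr>ground = E, rk = k, gps = extend_gp E k as ` gps M\<rparr>"
proof -
  have gp: "finite (ground M)" "gp_function (ground M) (rk M) \<phi>" using M by (auto simp: represents_def)
  have "gp_function E k (extend_gp E k as \<phi>)"
    using gp_function_pullback[OF gp(2), of id E as k xs] E as xs by (simp add: extend_gp_def list.map_id cong: if_cong)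
  moreover have "extend_gp E k as (\<lambda>xs. a * \<phi> xs) = (\<lambda>xs. a * extend_gp E k as \<phi> xs)" for a
    by (auto simp: extend_gp_def)
  then have "extend_gp E k as ` gps M = gp_class (extend_gp E k as \<phi>)"
    using M by (simp add: represents_def gp_class_def setcompr_eq_image image_image)
  ultimately show ?thesis using finite_subset[OF E gp(1)] by (simp add: represents_def)
qed

lemma max_indep_list_exists:
  assumes M: "represents \<phi> M" and A: "A \<subseteq> ground M"
  shows "\<exists>as. distinct as \<and> max_indep_in M A (set as)"
proof -
  have fin: "finite A" using M A finite_subset by (auto simp: represents_def)
  obtain xs where "\<phi> xs \<noteq> 0"
    using M unfolding represents_def gp_function_def by blast
  then have "indep M {}" using bases_iff[OF M] unfolding indep_def by blast
  then have "{} \<in> {I. I \<subseteq> A \<and> indep M I}" by blast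
  moreover have "finite {I. I \<subseteq> A \<and> indep M I}" using fin by simp
  ultimately obtain I where I: "I \<in> {I. I \<subseteq> A \<and> indep M I}"
    and max: "\<forall>J\<in>{I. I \<subseteq> A \<and> indep M I}. I \<subseteq> J \<longrightarrow> I = J"
    using finite_has_maximal2 by (metis (no_types, lifting))
  obtain as where as: "distinct as" "set as = I"
    using I fin finite_subset finite_distinct_list by (metis (no_types, lifting) mem_Collect_eq)
  have "max_indep_in M A I" unfolding max_indep_in_def using I max by blast
  then show ?thesis using as by blast
qed

text \<open>
  The last conclusion is the maximality of the contracted independent set \<open>as\<close>. It says that the
  functions \<open>e \<mapsto> \<phi>(e, \<dots>)\<close> that define the cocircuits of \<open>M/A\<close> vanish on \<open>A\<close>, so that they are
  cocircuits of \<open>M\<close> as they stand.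
\<close>

lemma contract_representation:
  assumes M: "represents \<phi> M" and A: "A \<subseteq> ground M"
  obtains as where "ground (contract M A) = ground M - A"
    and "set as \<subseteq> A" and "max_indep_in M A (set as)" and "distinct as"
    and "rk (contract M A) + length as = rk M"
    and "represents (extend_gp (ground M - A) (rk (contract M A)) as \<phi>) (contract M A)"
    and "\<And>e zs. e \<in> A \<Longrightarrow> \<phi> (e # zs @ as) = 0"
proof -
  have gp: "gp_function (ground M) (rk M) \<phi>" using M by (auto simp: represents_def)
  define as where "as = contract_list M A"
  have as: "distinct as" "max_indep_in M A (set as)"
    using someI_ex[OF max_indep_list_exists[OF M A]] unfolding as_def contract_list_def by auto
  then have as_A: "set as \<subseteq> A" and "indep M (set as)" by (auto simp: max_indep_in_def)
  then obtain B where B: "B \<in> bases M" "set as \<subseteq> B" unfolding indep_def by blast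
  obtain xs where xs: "distinct xs" "set xs = B - set as"
    using basis_card(3)[OF M B(1)] by (metis finite_Diff finite_distinct_list)
  \<comment> \<open>By maximality \<open>B\<close> meets \<open>A\<close> only in \<open>as\<close>, so \<open>xs\<close> lies in the new ground set
    and witnesses that the contracted function is nonzero.\<close>
  have nonzero: "\<phi> (xs @ as) \<noteq> 0"
    using xs as B by (intro basis_list[OF M]) (auto simp: Un_absorb2)
  have "length as \<le> rk M" using gp_support_length[OF gp nonzero] by simp
  have "indep M (B \<inter> A)" using B unfolding indep_def by blast
  moreover have "set as \<subseteq> B \<inter> A" using B as_A by blast
  ultimately have "B \<inter> A = set as" using as(2) unfolding max_indep_in_def by (metis inf_le2)
  then have "set xs \<subseteq> ground M - A" using xs basis_card(2)[OF M B(1)] by blast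
  then have rep: "represents (extend_gp (ground M - A) (rk M - length as) as \<phi>)
      \<lparr>ground = ground M - A, rk = rk M - length as,
       gps = extend_gp (ground M - A) (rk M - length as) as ` gps M\<rparr>"
    using represents_extend_gp[OF M _ _ _ _ nonzero, of "ground M - A" "rk M - length as"]
      as_A A \<open>length as \<le> rk M\<close> by auto
  have eq: "contract M A = \<lparr>ground = ground M - A, rk = rk M - length as,
       gps = extend_gp (ground M - A) (rk M - length as) as ` gps M\<rparr>"
    unfolding contract_def Let_def extend_gp_def as_def[symmetric] ..
  have "\<phi> (e # zs @ as) = 0" if e: "e \<in> A" for e zs
  proof (rule ccontr)
    assume nz: "\<phi> (e # zs @ as) \<noteq> 0"
    then have "set (e # zs @ as) \<in> bases M" using bases_iff[OF M] by blast
    then have "indep M (insert e (set as))" unfolding indep_def by (rule rev_bexI) auto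
    moreover have "insert e (set as) \<subseteq> A" using e as_A by blast
    ultimately have "insert e (set as) = set as" using as(2) unfolding max_indep_in_def by blast
    then show False using gp_support_distinct[OF gp nz] by auto
  qed
  then show ?thesis using that[of as] rep eq as as_A \<open>length as \<le> rk M\<close> by simp
qed

lemma rank_of_eq_card_max_indep:
  assumes M: "represents \<phi> M" and A: "A \<subseteq> ground M" and I: "max_indep_in M A I"
  shows "rank_of M A = card I"
  unfolding rank_of_def
proof (rule Max_eqI)
  have "finite A" using M A finite_subset by (auto simp: represents_def)
  then have "finite {J. J \<subseteq> A \<and> indep M J}" by simp
  then show "finite {card J |J. J \<subseteq> A \<and> indep M J}" by (auto simp: setcompr_eq_image)
  show "card I \<in> {card J |J. J \<subseteq> A \<and> indep M J}" using I by (auto simp: max_indep_in_def)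
  show "n \<le> card I" if "n \<in> {card J |J. J \<subseteq> A \<and> indep M J}" for n
    using that indep_card_le_max_indep[OF M I] by blast
qed

text \<open>
  The list \<open>bs\<close> completes a maximal independent subset of \<open>A\<close> to a basis of \<open>M\<close>. The last conclusion
  holds because an independent subset of \<open>A\<close> has no more elements than the rank of \<open>A\<close>; it is what
  makes circuits of \<open>M|A\<close> circuits of \<open>M\<close>.
\<close>

lemma restrict_representation:
  assumes M: "represents \<phi> M" and A: "A \<subseteq> ground M"
  obtains bs where "ground (restrict_to M A) = A" and "set bs \<subseteq> ground M - A" and "distinct bs"
    and "rk (restrict_to M A) + length bs = rk M"
    and "represents (extend_gp A (rk (restrict_to M A)) bs \<phi>) (restrict_to M A)"
    and "\<And>ys ws. set ys \<subseteq> A \<Longrightarrow> length ys = Suc (rk (restrict_to M A)) \<Longrightarrow> \<phi> (ys @ ws) = 0"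
proof -
  have gp: "gp_function (ground M) (rk M) \<phi>" using M by (auto simp: represents_def)
  obtain as where as: "set as \<subseteq> A" "max_indep_in M A (set as)" "distinct as"
      "rk (contract M A) + length as = rk M"
    and C: "represents (extend_gp (ground M - A) (rk (contract M A)) as \<phi>) (contract M A)"
    using contract_representation[OF M A] by metis
  have AA: "ground M - (ground M - A) = A" using A by blast
  define bs where "bs = delete_list M (ground M - A)"
  obtain us where us: "extend_gp (ground M - A) (rk (contract M A)) as \<phi> us \<noteq> 0"
    using C unfolding represents_def gp_function_def by blast
  then have "distinct us" "set us \<in> bases (contract M A)"
    using bases_iff[OF C] C gp_support_distinct unfolding represents_def by blast+
  then have "\<exists>bs. distinct bs \<and> set bs \<in> bases (contract M (ground M - (ground M - A)))"
    unfolding AA by blast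
  from someI_ex[OF this] have bs: "distinct bs" "set bs \<in> bases (contract M A)"
    unfolding bs_def delete_list_def AA by auto
  have "extend_gp (ground M - A) (rk (contract M A)) as \<phi> bs \<noteq> 0"
    using basis_list[OF C bs(2,1)] .
  then have "\<phi> (bs @ as) \<noteq> 0" and len: "length bs = rk (contract M A)"
    and bs_A: "set bs \<subseteq> ground M - A"
    by (auto simp: extend_gp_def tuples_def split: if_splits)
  \<comment> \<open>The enumeration \<open>as\<close> of a maximal independent subset of \<open>A\<close> shows that the
    restricted function is nonzero.\<close>
  then have nonzero: "\<phi> (as @ bs) \<noteq> 0"
    using gp_nonzero_mset[OF gp, of "as @ bs" "bs @ as"] by (simp add: add.commute)
  have rank: "rank_of M A = length as"
    using rank_of_eq_card_max_indep[OF M A as(2)] as(3) by (simp add: distinct_card)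
  have bs_M: "set bs \<subseteq> ground M" using bs_A by blast
  have rep: "represents (extend_gp A (length as) bs \<phi>)
      \<lparr>ground = A, rk = length as, gps = extend_gp A (length as) bs ` gps M\<rparr>"
    using represents_extend_gp[OF M A bs_M _ as(1) nonzero] len as(4) by simp
  have eq: "restrict_to M A
      = \<lparr>ground = A, rk = length as, gps = extend_gp A (length as) bs ` gps M\<rparr>"
    unfolding restrict_to_def delete_def Let_def extend_gp_def bs_def[symmetric] AA rank ..
  have "\<phi> (ys @ ws) = 0" if ys: "set ys \<subseteq> A" "length ys = Suc (length as)" for ys ws
  proof (rule ccontr)
    assume nz: "\<phi> (ys @ ws) \<noteq> 0"
    then have "set (ys @ ws) \<in> bases M" using bases_iff[OF M] by blast
    then have "indep M (set ys)" unfolding indep_def by (rule rev_bexI) auto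
    then have "card (set ys) \<le> card (set as)" using indep_card_le_max_indep[OF M as(2) ys(1)] by blast
    then show False using gp_support_distinct[OF gp nz] as(3) ys(2) by (simp add: distinct_card)
  qed
  then show ?thesis using that[of bs] rep eq bs_A bs(1) len as(4) by simp
qed

lemma vectors_contractI:
  assumes M: "represents \<phi> M" and B: "B \<subseteq> ground M" and X: "X \<in> vects (ground M - B)"
    and orth: "\<And>zs. set zs \<subseteq> ground M \<Longrightarrow> Suc (length zs) = rk M \<Longrightarrow> (\<forall>e\<in>B. \<phi> (e # zs) = 0) \<Longrightarrow>
      orth (ground M - B) X (\<lambda>e. \<phi> (e # zs))"
  shows "X \<in> vectors (contract M B)"
proof -
  obtain as where as: "ground (contract M B) = ground M - B" "set as \<subseteq> B"
      "rk (contract M B) + length as = rk M" "\<And>e zs. e \<in> B \<Longrightarrow> \<phi> (e # zs @ as) = 0"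
    and C: "represents (extend_gp (ground M - B) (rk (contract M B)) as \<phi>) (contract M B)"
    using contract_representation[OF M B] by metis
  show ?thesis
    unfolding vectors_iff[OF C] as(1)
  proof (intro conjI allI impI X)
    fix zs assume zs: "set zs \<subseteq> ground M - B" "Suc (length zs) = rk (contract M B)"
    have "orth (ground M - B) X (\<lambda>e. \<phi> (e # zs @ as))"
    proof (rule orth[of "zs @ as"])
      show "set (zs @ as) \<subseteq> ground M" using zs(1) as(2) B by auto
    qed (use zs as in auto)
    then show "(\<Sum>e\<in>ground M - B. emb (X e * extend_gp (ground M - B) (rk (contract M B)) as \<phi> (e # zs)))
        \<in> nullset"
      using zs by (simp add: orth_def extend_gp_def tuples_def)
  qed
qed

lemma vectors_restrictI:
  assumes M: "represents \<phi> M" and B: "B \<subseteq> ground M" and X: "X \<in> vects B"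
    and orth: "\<And>zs. set zs \<subseteq> ground M \<Longrightarrow> Suc (length zs) = rk M \<Longrightarrow> orth B X (\<lambda>e. \<phi> (e # zs))"
  shows "X \<in> vectors (restrict_to M B)"
proof -
  obtain bs where bs: "ground (restrict_to M B) = B" "set bs \<subseteq> ground M - B"
      "rk (restrict_to M B) + length bs = rk M"
    and R: "represents (extend_gp B (rk (restrict_to M B)) bs \<phi>) (restrict_to M B)"
    using restrict_representation[OF M B] by metis
  show ?thesis
    unfolding vectors_iff[OF R] bs(1)
  proof (intro conjI allI impI X)
    fix zs assume zs: "set zs \<subseteq> B" "Suc (length zs) = rk (restrict_to M B)"
    have "orth B X (\<lambda>e. \<phi> (e # zs @ bs))"
    proof (rule orth[of "zs @ bs"])
      show "set (zs @ bs) \<subseteq> ground M" using zs(1) bs(2) B by auto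
    qed (use zs bs in auto)
    then show "(\<Sum>e\<in>B. emb (X e * extend_gp B (rk (restrict_to M B)) bs \<phi> (e # zs))) \<in> nullset"
      using zs by (simp add: orth_def extend_gp_def tuples_def)
  qed
qed

text \<open>
  The circuit of \<open>N/A\<close> given by \<open>ys\<close> is the restriction of the circuit of \<open>N\<close> given by \<open>ys @ as\<close>. The
  latter may be nonzero on \<open>as\<close> as well, but there \<open>W\<close> vanishes, so both have the same pairing with \<open>W\<close>.
\<close>

lemma covectors_contract:
  assumes N: "represents \<phi> N" and A: "A \<subseteq> ground N"
    and W: "W \<in> covectors N" "\<And>e. e \<in> A \<Longrightarrow> W e = 0"
  shows "W \<in> covectors (contract N A)"
proof -
  obtain as where as: "ground (contract N A) = ground N - A" "set as \<subseteq> A" "distinct as"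
      "rk (contract N A) + length as = rk N"
    and C: "represents (extend_gp (ground N - A) (rk (contract N A)) as \<phi>) (contract N A)"
    using contract_representation[OF N A] by metis
  let ?k = "rk (contract N A)"
  show ?thesis
    unfolding covectors_iff[OF C] as(1)
  proof (intro conjI allI impI)
    show "W \<in> vects (ground N - A)" using W by (auto simp: covectors_def vects_def)
    fix ys assume ys: "set ys \<subseteq> ground N - A" "distinct ys" "length ys = Suc ?k"
    let ?T = "\<lambda>i. emb (W ((ys @ as) ! i) * (neg_one ^ i * \<phi> (omit i (ys @ as))))"
    have "(\<Sum>i\<le>rk N. ?T i) \<in> nullset"
    proof -
      have "set (ys @ as) \<subseteq> ground N" "distinct (ys @ as)" "length (ys @ as) = Suc (rk N)"
        using ys as A by auto
      then show ?thesis using W(1) unfolding covectors_iff[OF N] by blast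
    qed
    moreover have "(\<Sum>i\<le>rk N. ?T i) = (\<Sum>i\<le>?k. ?T i)"
    proof (rule sum.mono_neutral_right)
      show "\<forall>i\<in>{..rk N} - {..?k}. ?T i = {#}"
      proof
        fix i assume "i \<in> {..rk N} - {..?k}"
        then have "(ys @ as) ! i \<in> set as" using ys as by (auto simp: nth_append)
        then have "W ((ys @ as) ! i) = 0" using W(2) as(2) by blast
        then show "?T i = {#}" by simp
      qed
    qed (use as in auto)
    moreover have "?T i = emb (W (ys ! i) * (neg_one ^ i * extend_gp (ground N - A) ?k as \<phi> (omit i ys)))"
      if "i \<le> ?k" for i
    proof -
      have "omit i ys \<in> tuples (ground N - A) ?k"
        using that ys set_omit[of i ys] length_omit[of i ys] by (auto simp: tuples_def)
      then show ?thesis using that ys by (simp add: extend_gp_def omit_append_left nth_append)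
    qed
    ultimately show "(\<Sum>i\<le>?k. emb (W (ys ! i) *
        (neg_one ^ i * extend_gp (ground N - A) ?k as \<phi> (omit i ys)))) \<in> nullset" by simp
  qed
qed

text \<open>
  The circuit of \<open>N\<close> given by \<open>ys @ bs\<close> is supported on \<open>ys\<close>: if an entry of \<open>bs\<close> is omitted, all of
  \<open>ys\<close> remains, which has more elements than the rank of \<open>A\<close>.
\<close>

lemma covectors_restrict:
  assumes N: "represents \<phi> N" and A: "A \<subseteq> ground N" and W: "W \<in> covectors N"
  shows "(\<lambda>e. if e \<in> A then W e else 0) \<in> covectors (restrict_to N A)"
proof -
  obtain bs where bs: "ground (restrict_to N A) = A" "set bs \<subseteq> ground N - A" "distinct bs"
      "rk (restrict_to N A) + length bs = rk N"
      "\<And>ys ws. set ys \<subseteq> A \<Longrightarrow> length ys = Suc (rk (restrict_to N A)) \<Longrightarrow> \<phi> (ys @ ws) = 0"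
    and R: "represents (extend_gp A (rk (restrict_to N A)) bs \<phi>) (restrict_to N A)"
    using restrict_representation[OF N A] by metis
  let ?k = "rk (restrict_to N A)"
  show ?thesis
    unfolding covectors_iff[OF R] bs(1)
  proof (intro conjI allI impI)
    show "(\<lambda>e. if e \<in> A then W e else 0) \<in> vects A" by (simp add: vects_def)
    fix ys assume ys: "set ys \<subseteq> A" "distinct ys" "length ys = Suc ?k"
    let ?T = "\<lambda>i. emb (W ((ys @ bs) ! i) * (neg_one ^ i * \<phi> (omit i (ys @ bs))))"
    let ?U = "\<lambda>i. emb ((if ys ! i \<in> A then W (ys ! i) else 0) *
        (neg_one ^ i * extend_gp A ?k bs \<phi> (omit i ys)))"
    have T: "?T i = ?U i" if "i \<le> ?k" for i
    proof -
      have "omit i ys \<in> tuples A ?k"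
        using that ys set_omit[of i ys] length_omit[of i ys] by (auto simp: tuples_def)
      moreover have "ys ! i \<in> A" using that ys by auto
      ultimately show ?thesis using that ys by (simp add: extend_gp_def omit_append_left nth_append)
    qed
    have "distinct (ys @ bs)" "set (ys @ bs) \<subseteq> ground N" "length (ys @ bs) = Suc (rk N)"
      using ys bs A by auto
    then have "(\<Sum>i\<le>rk N. ?T i) \<in> nullset" using W unfolding covectors_iff[OF N] by blast
    moreover have "(\<Sum>i\<le>rk N. ?T i) = (\<Sum>i\<le>?k. ?T i)"
    proof (rule sum.mono_neutral_right)
      show "\<forall>i\<in>{..rk N} - {..?k}. ?T i = {#}"
        using ys bs(5)[OF ys(1,3)] by (simp add: omit_append_right)
    qed (use bs in auto)
    ultimately show "(\<Sum>i\<le>?k. ?U i) \<in> nullset" using T by simp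
  qed
qed


section \<open>Submonomial matrices\<close>

lemma submonomialD:
  assumes "submonomial \<Phi>"
  shows "entry \<Phi> i j \<noteq> 0 \<Longrightarrow> i \<in> rows \<Phi> \<and> j \<in> cols \<Phi>"
    and "entry \<Phi> i j \<noteq> 0 \<Longrightarrow> entry \<Phi> i j' \<noteq> 0 \<Longrightarrow> j = j'"
    and "entry \<Phi> i j \<noteq> 0 \<Longrightarrow> entry \<Phi> i' j \<noteq> 0 \<Longrightarrow> i = i'"
  using assms unfolding submonomial_def by blast+

lemma submonomial_transpose:
  assumes "submonomial \<Phi>"
  shows "submonomial (mat_transpose \<Phi>)"
  unfolding submonomial_def mat_transpose_def using submonomialD[OF assms] by simp blast

lemma mat_apply_zero_row:
  assumes "\<And>j. entry \<Phi> i j = 0"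
  shows "mat_apply \<Phi> X i = 0"
proof -
  have "(\<Sum>j\<in>cols \<Phi>. emb (entry \<Phi> i j * X j)) = emb 0" by (simp add: assms)
  then show ?thesis unfolding mat_apply_def by (simp only: emb_eq_iff the_eq_trivial)
qed

lemma mat_apply_row:
  assumes \<Phi>: "submonomial \<Phi>" "finite (cols \<Phi>)" and nonzero: "entry \<Phi> i j \<noteq> 0"
  shows "mat_apply \<Phi> X i = entry \<Phi> i j * X j"
proof -
  have "j \<in> cols \<Phi>" using submonomialD(1)[OF \<Phi>(1) nonzero] by blast
  moreover have "emb (entry \<Phi> i j' * X j') = {#}" if "j' \<noteq> j" for j'
  proof -
    have "entry \<Phi> i j' = 0" using submonomialD(2)[OF \<Phi>(1) nonzero, of j'] that by blast
    then show ?thesis by simp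
  qed
  ultimately have "(\<Sum>j\<in>cols \<Phi>. emb (entry \<Phi> i j * X j)) = emb (entry \<Phi> i j * X j)"
    using \<Phi>(2) by (simp add: sum.remove)
  then show ?thesis unfolding mat_apply_def by (simp only: emb_eq_iff the_eq_trivial)
qed

text \<open>
  As a row has at most one nonzero entry, the matrix product, which is an element of \<open>F\<close>, may be
  expanded as a sum in the group semiring.
\<close>

lemma emb_mat_apply:
  assumes \<Phi>: "submonomial \<Phi>" "finite (cols \<Phi>)"
  shows "emb (mat_apply \<Phi> X i * y) = (\<Sum>j\<in>cols \<Phi>. emb (entry \<Phi> i j * X j * y))"
proof (cases "\<exists>j. entry \<Phi> i j \<noteq> 0")
  case True
  then obtain j where j: "entry \<Phi> i j \<noteq> 0" by blast
  have "j \<in> cols \<Phi>" using submonomialD(1)[OF \<Phi>(1) j] by blast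
  moreover have "emb (entry \<Phi> i j' * X j' * y) = {#}" if "j' \<noteq> j" for j'
  proof -
    have "entry \<Phi> i j' = 0" using submonomialD(2)[OF \<Phi>(1) j, of j'] that by blast
    then show ?thesis by simp
  qed
  ultimately show ?thesis
    using \<Phi>(2) mat_apply_row[OF \<Phi> j] by (simp add: sum.remove)
next
  case False
  then show ?thesis by (simp add: mat_apply_zero_row)
qed

text \<open>
  Both sides expand to the double sum of \<open>\<Phi>\<^sub>i\<^sub>j X\<^sub>j Y\<^sub>i\<close>.
\<close>

lemma mat_transpose_adjoint:
  assumes \<Phi>: "submonomial \<Phi>" "finite (rows \<Phi>)" "finite (cols \<Phi>)"
  shows "(\<Sum>i\<in>rows \<Phi>. emb (mat_apply \<Phi> X i * Y i))
    = (\<Sum>j\<in>cols \<Phi>. emb (X j * mat_apply (mat_transpose \<Phi>) Y j))"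
proof -
  let ?\<Psi> = "mat_transpose \<Phi>"
  have \<Psi>: "cols ?\<Psi> = rows \<Phi>" "\<And>i j. entry ?\<Psi> j i = entry \<Phi> i j"
    by (simp_all add: mat_transpose_def)
  have "(\<Sum>i\<in>rows \<Phi>. emb (mat_apply \<Phi> X i * Y i))
      = (\<Sum>i\<in>rows \<Phi>. \<Sum>j\<in>cols \<Phi>. emb (entry \<Phi> i j * X j * Y i))"
    by (simp only: emb_mat_apply[OF \<Phi>(1,3)])
  also have "\<dots> = (\<Sum>j\<in>cols \<Phi>. \<Sum>i\<in>rows \<Phi>. emb (entry ?\<Psi> j i * Y i * X j))"
    by (subst sum.swap) (simp add: \<Psi> mult_ac)
  also have "\<dots> = (\<Sum>j\<in>cols \<Phi>. emb (mat_apply ?\<Psi> Y j * X j))"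
    using emb_mat_apply[OF submonomial_transpose[OF \<Phi>(1)], of Y] \<Phi>(2) by (simp add: \<Psi>)
  finally show ?thesis by (simp add: mult.commute)
qed

lemma mat_apply_vects:
  assumes "submonomial \<Phi>"
  shows "mat_apply \<Phi> X \<in> vects (rows \<Phi>)"
  unfolding vects_def
proof (intro CollectI allI impI)
  fix i assume "i \<notin> rows \<Phi>"
  then show "mat_apply \<Phi> X i = 0"
    using submonomialD(1)[OF assms, of i] by (intro mat_apply_zero_row) blast
qed


section \<open>Restriction and contraction of morphisms\<close>

text \<open>
  In terms of the duals, \<open>\<Phi>\<^sup>t\<close> sends circuits of \<open>M\<^sup>*\<close> to vectors of \<open>N\<^sup>*\<close>. Circuits \<open>Z\<close> of \<open>N\<close> are
  vectors, so \<open>\<Phi> Z\<close> is orthogonal to the cocircuits of \<open>M\<close>, and the adjoint moves \<open>\<Phi>\<close> to the other side.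
\<close>

lemma transpose_cofactor_covector:
  assumes mor: "F_morphism N M \<Phi>" and N: "represents \<psi> N" and M: "represents \<phi> M"
    and zs: "set zs \<subseteq> ground M" "Suc (length zs) = rk M"
  shows "mat_apply (mat_transpose \<Phi>) (\<lambda>i. \<phi> (i # zs)) \<in> covectors N"
proof -
  let ?Y = "\<lambda>i. \<phi> (i # zs)"
  have \<Phi>: "submonomial \<Phi>" "rows \<Phi> = ground M" "cols \<Phi> = ground N"
    and vec: "mat_apply \<Phi> ` vectors N \<subseteq> vectors M"
    using mor by (auto simp: F_morphism_def)
  have fin: "finite (rows \<Phi>)" "finite (cols \<Phi>)" using M N \<Phi> by (auto simp: represents_def)
  have "orth (ground N) (mat_apply (mat_transpose \<Phi>) ?Y) Z" if "Z \<in> circuits N" for Z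
  proof -
    have "mat_apply \<Phi> Z \<in> vectors M" using that vec circuits_subset_vectors[OF N] by blast
    then have "(\<Sum>i\<in>ground M. emb (mat_apply \<Phi> Z i * ?Y i)) \<in> nullset"
      using zs unfolding vectors_iff[OF M] by blast
    then show ?thesis
      using mat_transpose_adjoint[OF \<Phi>(1) fin, of Z ?Y] \<Phi>(2,3) by (simp add: orth_def mult.commute)
  qed
  moreover have "mat_apply (mat_transpose \<Phi>) ?Y \<in> vects (ground N)"
    using mat_apply_vects[OF submonomial_transpose[OF \<Phi>(1)], of ?Y] \<Phi>(3)
    by (simp add: mat_transpose_def)
  ultimately show ?thesis by (simp add: covectors_def)
qed

text \<open>
  The condition on the underlying map in the form used below: \<open>\<Phi>\<close> vanishes on \<open>B\<^sup>c \<times> A\<close>.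
\<close>

lemma underlying_map_entry:
  assumes "submonomial \<Phi>" "underlying_map \<Phi> ` pointed A \<subseteq> pointed B"
    and "j \<in> A" "entry \<Phi> i j \<noteq> 0"
  shows "i \<in> B"
proof -
  have "(THE i. entry \<Phi> i j \<noteq> 0) = i"
    using assms(4) submonomialD(3)[OF assms(1)] by (intro the_equality) auto
  then have "underlying_map \<Phi> (Some j) = Some i" using assms(4) by (auto simp: underlying_map_def)
  moreover have "Some j \<in> pointed A" using assms(3) by (simp add: pointed_def)
  ultimately have "Some i \<in> pointed B" using assms(2) by (metis image_subset_iff)
  then show ?thesis by (auto simp: pointed_def)
qed

text \<open>
  For \<open>j \<in> A\<close> the nonzero entry of column \<open>j\<close>, if any, lies in a row of \<open>B\<close>, so \<open>\<Phi>\<^sup>t Y\<close> agrees on \<open>A\<close>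
  with the product of \<open>Y\<close> and the transpose of the restricted matrix. Perfection of \<open>F\<close>, applied to
  \<open>N|A\<close>, makes it orthogonal to the vectors of \<open>N|A\<close>.
\<close>

lemma F_morphism_restrict:
  fixes N :: "('s, 'f::idyll) fmatroid" and M :: "('t, 'f) fmatroid"
  assumes perfect: "perfect_idyll TYPE('f)" and mor: "F_morphism N M \<Phi>"
    and A: "A \<subseteq> ground N" and B: "B \<subseteq> ground M"
    and AB: "\<And>i j. j \<in> A \<Longrightarrow> entry \<Phi> i j \<noteq> 0 \<Longrightarrow> i \<in> B"
  shows "F_morphism (restrict_to N A) (restrict_to M B) (mat_restrict \<Phi> A B)"
proof -
  let ?\<Phi> = "mat_restrict \<Phi> A B"
  obtain \<psi> \<phi> where N: "represents \<psi> N" and M: "represents \<phi> M"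
    using mor unfolding F_morphism_def F_matroid_iff_represents by blast
  obtain \<psi>' where N': "ground (restrict_to N A) = A" "represents \<psi>' (restrict_to N A)"
    using restrict_representation[OF N A] by metis
  obtain \<phi>' where M': "ground (restrict_to M B) = B" "represents \<phi>' (restrict_to M B)"
    using restrict_representation[OF M B] by metis
  have \<Phi>: "submonomial \<Phi>" "rows \<Phi> = ground M" "cols \<Phi> = ground N"
    using mor by (auto simp: F_morphism_def)
  have res: "rows ?\<Phi> = B" "cols ?\<Phi> = A"
    "\<And>i j. entry ?\<Phi> i j = (if i \<in> B \<and> j \<in> A then entry \<Phi> i j else 0)"
    by (simp_all add: mat_restrict_def)
  have sub: "submonomial ?\<Phi>"
    unfolding submonomial_def res using submonomialD[OF \<Phi>(1)] by auto
  have fin: "finite (ground M)" "finite (ground N)" using M N by (auto simp: represents_def)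
  have fin': "finite A" "finite B" using A B fin finite_subset by blast+
  have "mat_apply ?\<Phi> X \<in> vectors (restrict_to M B)" if X: "X \<in> vectors (restrict_to N A)" for X
  proof (rule vectors_restrictI[OF M B])
    show "mat_apply ?\<Phi> X \<in> vects B" using mat_apply_vects[OF sub] res by metis
    fix zs assume zs: "set zs \<subseteq> ground M" "Suc (length zs) = rk M"
    let ?Y = "\<lambda>i. \<phi> (i # zs)"
    let ?W = "mat_apply (mat_transpose \<Phi>) ?Y"
    have "?W \<in> covectors N" by (rule transpose_cofactor_covector[OF mor N M zs])
    then have "(\<lambda>e. if e \<in> A then ?W e else 0) \<in> covectors (restrict_to N A)"
      by (rule covectors_restrict[OF N A])
    from perfect_orth[OF perfect N'(2) X this]
    have "(\<Sum>j\<in>A. emb (X j * ?W j)) \<in> nullset" by (simp add: orth_def N'(1))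
    moreover have "mat_apply (mat_transpose ?\<Phi>) ?Y j = ?W j" if j: "j \<in> A" for j
    proof (cases "\<exists>i. entry \<Phi> i j \<noteq> 0")
      case True
      then obtain i where i: "entry \<Phi> i j \<noteq> 0" by blast
      then have "i \<in> B" using AB j by blast
      then show ?thesis
        using mat_apply_row[OF submonomial_transpose[OF \<Phi>(1)], of j i ?Y]
          mat_apply_row[OF submonomial_transpose[OF sub], of j i ?Y] i j fin fin' \<Phi>(2)
        by (simp add: mat_transpose_def res)
    next
      case False
      then have "entry (mat_transpose \<Phi>) j i = 0" "entry (mat_transpose ?\<Phi>) j i = 0" for i
        by (simp_all add: mat_transpose_def res)
      then show ?thesis by (simp add: mat_apply_zero_row)
    qed
    ultimately show "orth B (mat_apply ?\<Phi> X) ?Y"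
      using mat_transpose_adjoint[OF sub, of X ?Y] fin' by (simp add: orth_def res)
  qed
  moreover have "F_matroid (restrict_to N A)" "F_matroid (restrict_to M B)"
    using N'(2) M'(2) F_matroid_iff_represents by blast+
  ultimately show ?thesis
    unfolding F_morphism_def using sub res(1,2) N'(1) M'(1) by (simp add: image_subset_iff)
qed

text \<open>
  Here \<open>Y\<close> vanishes on \<open>B\<close>. A column in \<open>A\<close> has its nonzero entry in a row of \<open>B\<close>, so \<open>\<Phi>\<^sup>t Y\<close> vanishes
  on \<open>A\<close> and is a covector of \<open>N/A\<close>. A column outside \<open>A\<close> may also have its nonzero entry in a row
  of \<open>B\<close>, where the contracted matrix loses it; but then \<open>\<Phi>\<^sup>t Y\<close> is zero there as well.
\<close>

lemma F_morphism_contract: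
  fixes N :: "('s, 'f::idyll) fmatroid" and M :: "('t, 'f) fmatroid"
  assumes perfect: "perfect_idyll TYPE('f)" and mor: "F_morphism N M \<Phi>"
    and A: "A \<subseteq> ground N" and B: "B \<subseteq> ground M"
    and AB: "\<And>i j. j \<in> A \<Longrightarrow> entry \<Phi> i j \<noteq> 0 \<Longrightarrow> i \<in> B"
  shows "F_morphism (contract N A) (contract M B) (mat_contract \<Phi> A B)"
proof -
  let ?\<Phi> = "mat_contract \<Phi> A B" and ?A = "ground N - A" and ?B = "ground M - B"
  obtain \<psi> \<phi> where N: "represents \<psi> N" and M: "represents \<phi> M"
    using mor unfolding F_morphism_def F_matroid_iff_represents by blast
  obtain \<psi>' where N': "ground (contract N A) = ?A" "represents \<psi>' (contract N A)"
    using contract_representation[OF N A] by metis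
  obtain \<phi>' where M': "ground (contract M B) = ?B" "represents \<phi>' (contract M B)"
    using contract_representation[OF M B] by metis
  have \<Phi>: "submonomial \<Phi>" "rows \<Phi> = ground M" "cols \<Phi> = ground N"
    using mor by (auto simp: F_morphism_def)
  have con: "rows ?\<Phi> = ?B" "cols ?\<Phi> = ?A"
    "\<And>i j. entry ?\<Phi> i j = (if i \<in> ?B \<and> j \<in> ?A then entry \<Phi> i j else 0)"
    by (simp_all add: mat_contract_def Let_def \<Phi>)
  have sub: "submonomial ?\<Phi>"
    unfolding submonomial_def con using submonomialD[OF \<Phi>(1)] by auto
  have fin: "finite (ground M)" "finite (ground N)" using M N by (auto simp: represents_def)
  have "mat_apply ?\<Phi> X \<in> vectors (contract M B)" if X: "X \<in> vectors (contract N A)" for X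
  proof (rule vectors_contractI[OF M B])
    show "mat_apply ?\<Phi> X \<in> vects ?B" using mat_apply_vects[OF sub] con by metis
    fix zs assume zs: "set zs \<subseteq> ground M" "Suc (length zs) = rk M" "\<forall>e\<in>B. \<phi> (e # zs) = 0"
    let ?Y = "\<lambda>i. \<phi> (i # zs)"
    let ?W = "mat_apply (mat_transpose \<Phi>) ?Y"
    have W_row: "?W j = entry \<Phi> i j * ?Y i" if "entry \<Phi> i j \<noteq> 0" for i j
      using mat_apply_row[OF submonomial_transpose[OF \<Phi>(1)], of j i ?Y] that fin \<Phi>(2)
      by (simp add: mat_transpose_def)
    have W_zero: "?W j = 0" if "\<And>i. entry \<Phi> i j = 0" for j
      using that by (intro mat_apply_zero_row) (simp add: mat_transpose_def)
    have "?W j = 0" if "j \<in> A" for j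
      using that AB zs(3) W_row W_zero by (metis mult_zero_right)
    then have "?W \<in> covectors (contract N A)"
      using transpose_cofactor_covector[OF mor N M zs(1,2)] by (intro covectors_contract[OF N A])
    from perfect_orth[OF perfect N'(2) X this]
    have "(\<Sum>j\<in>?A. emb (X j * ?W j)) \<in> nullset" by (simp add: orth_def N'(1))
    moreover have "mat_apply (mat_transpose ?\<Phi>) ?Y j = ?W j" if j: "j \<in> ?A" for j
    proof (cases "\<exists>i\<in>?B. entry \<Phi> i j \<noteq> 0")
      case True
      then obtain i where i: "i \<in> ?B" "entry \<Phi> i j \<noteq> 0" by blast
      then show ?thesis
        using mat_apply_row[OF submonomial_transpose[OF sub], of j i ?Y] W_row[OF i(2)] j fin
        by (simp add: mat_transpose_def con)
    next
      case False
      then have "entry (mat_transpose ?\<Phi>) j i = 0" for i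
        by (auto simp: mat_transpose_def con)
      then have "mat_apply (mat_transpose ?\<Phi>) ?Y j = 0" by (rule mat_apply_zero_row)
      moreover have "?W j = 0"
      proof (cases "\<exists>i. entry \<Phi> i j \<noteq> 0")
        case True
        then obtain i where i: "entry \<Phi> i j \<noteq> 0" by blast
        then have "i \<in> B" using False submonomialD(1)[OF \<Phi>(1) i] \<Phi>(2) by blast
        then show ?thesis using W_row[OF i] zs(3) by simp
      qed (simp add: W_zero)
      ultimately show ?thesis by simp
    qed
    ultimately show "orth ?B (mat_apply ?\<Phi> X) ?Y"
      using mat_transpose_adjoint[OF sub, of X ?Y] fin by (simp add: orth_def con)
  qed
  moreover have "F_matroid (contract N A)" "F_matroid (contract M B)"
    using N'(2) M'(2) F_matroid_iff_represents by blast+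
  ultimately show ?thesis
    unfolding F_morphism_def using sub con(1,2) N'(1) M'(1) by (simp add: image_subset_iff)
qed

theorem propositionF:
  fixes N :: "('s, 'f::idyll) fmatroid" and M :: "('t, 'f) fmatroid"
    and \<Phi> :: "('t, 's, 'f) fmatrix"
    and S A :: "'s set" and T B :: "'t set"
  assumes "perfect_idyll TYPE('f)"
    and "F_matroid N" and "F_matroid M"
    and "S = ground N" and "T = ground M"
    and "F_morphism N M \<Phi>"
    and "A \<subseteq> S" and "B \<subseteq> T"
    and "underlying_map \<Phi> ` pointed A \<subseteq> pointed B"
  shows "F_morphism (restrict_to N A) (restrict_to M B) (mat_restrict \<Phi> A B)
    \<and> F_morphism (contract N A) (contract M B) (mat_contract \<Phi> A B)
    \<and> mat_restrict (mat_transpose \<Phi>) (T - B) (S - A) = mat_transpose (mat_contract \<Phi> A B)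
    \<and> (\<forall>f :: 'f \<Rightarrow> 'g::idyll. perfect_idyll TYPE('g) \<and> idyll_hom f \<longrightarrow>
         mat_map f (mat_restrict \<Phi> A B) = mat_restrict (mat_map f \<Phi>) A B)"
proof (intro conjI allI impI)
  have \<Phi>: "submonomial \<Phi>" "rows \<Phi> = T" "cols \<Phi> = S"
    using assms(4,5,6) by (auto simp: F_morphism_def)
  note AB = underlying_map_entry[OF \<Phi>(1) assms(9)]
  show "F_morphism (restrict_to N A) (restrict_to M B) (mat_restrict \<Phi> A B)"
    using F_morphism_restrict[OF assms(1,6)] assms(4,5,7,8) AB by blast
  show "F_morphism (contract N A) (contract M B) (mat_contract \<Phi> A B)"
    using F_morphism_contract[OF assms(1,6)] assms(4,5,7,8) AB by blast
  show "mat_restrict (mat_transpose \<Phi>) (T - B) (S - A) = mat_transpose (mat_contract \<Phi> A B)"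
    using \<Phi> by (auto simp: mat_restrict_def mat_transpose_def mat_contract_def Let_def fun_eq_iff)
  fix f :: "'f \<Rightarrow> 'g::idyll"
  assume "perfect_idyll TYPE('g) \<and> idyll_hom f"
  then have "f 0 = 0" by (simp add: idyll_hom_def)
  then show "mat_map f (mat_restrict \<Phi> A B) = mat_restrict (mat_map f \<Phi>) A B"
    by (auto simp: mat_map_def mat_restrict_def fun_eq_iff)
qed

end
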